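(* Let $\gamma_1,\gamma_2$ be the instantaneous SNRs of the RF and optical hops described in the context, and let $$\gamma=\frac{\gamma_1\gamma_2}{\gamma_2+C},\qquad C=\mathbb{E}[\gamma_1]+1,$$ be the end-to-end SNR of amplify-and-forward relaying with ideal hardware ($\kappa_1=\kappa_2=0$). For a modulation parameter $c>0$, the average symbol error probability $\overline{P_e}=\mathbb{E}[\mathcal{Q}(\sqrt{c\gamma})]$ is $$\overline{P_e}=\frac12-\sqrt{\frac{c}{8\pi}}\,\frac{m\xi^2A}{2^r(2\pi)^{r-1}}\binom{M}{m}\sum_{k=0}^{m-1}\sum_{n=1}^{\beta}\binom{m-1}{k}\frac{(-1)^kb_n\,r^{\alpha+n-1}}{M-m+k+1}\sqrt{\frac{2\mu_1}{c\mu_1+2\zeta_1}}\;G_{r+1,3r+1}^{3r+1,1}\left(\frac{2\zeta_2}{(c\mu_1+2\zeta_1)\mu_r}\;\middle|\;\begin{matrix}\tau_6\\ \tau_4\end{matrix}\right),$$ where $\tau_6=[\tfrac12,\Delta(r:\xi^2+1)]$, $\tau_4=[\Delta(r:\xi^2),\Delta(r:\alpha),\Delta(r:n),0]$ and $$\zeta_1=\frac{M-m+k+1}{(M-m+k)(1-\rho_m)+1},\qquad \zeta_2=\frac{(M-m+k+1)\,C}{(M-m+k)(1-\rho_m)+1}\left(\frac{B}{r^2}\right)^r$$ (both depending on $k$).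
   Context: Notation. $\mathcal{Q}(x)=\frac{1}{\sqrt{2\pi}}\int_x^\infty e^{-t^2/2}dt$ is the Gaussian Q-function. $\Delta(j:x)$ denotes the list $\frac{x}{j},\frac{x+1}{j},\dots,\frac{x+j-1}{j}$. $G_{p,q}^{m,n}\left(z\,\middle|\,\begin{matrix}a_1,\dots,a_p\\ b_1,\dots,b_q\end{matrix}\right)$ is the Meijer G-function with the standard convention $\frac{1}{2\pi i}\int \frac{\prod_{j=1}^m\Gamma(b_j+s)\prod_{j=1}^n\Gamma(1-a_j-s)}{\prod_{j=m+1}^q\Gamma(1-b_j-s)\prod_{j=n+1}^p\Gamma(a_j+s)}z^{-s}ds$, the contour separating the poles of the $\Gamma(b_j+s)$ from those of the $\Gamma(1-a_j-s)$. RF hop. $M\ge1$ is the number of relays, $1\le m\le M$ the rank of the selected relay, $\rho_m\in[0,1]$ the time correlation coefficient between outdated and actual CSI, $\mu_1>0$ the average SNR of the first hop. $\gamma_1$ is a nonnegative random variable with density, for $x\ge0$, $$f_{\gamma_1}(x)=m\binom{M}{m}\sum_{k=0}^{m-1}\frac{(-1)^k\binom{m-1}{k}}{[(M-m+k)(1-\rho_m)+1]\mu_1}\exp\left(-\frac{(M-m+k+1)x}{[(M-m+k)(1-\rho_m)+1]\mu_1}\right),$$ so that $\mathbb{E}[\gamma_1]=m\binom{M}{m}\sum_{k=0}^{m-1}\binom{m-1}{k}(-1)^k\frac{[(M-m+k)(1-\rho_m)+1]\mu_1}{(M-m+k+1)^2}$. Optical hop. $r\in\{1,2\}$ is the detection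 type, $\mu_r>0$ the average electrical SNR, $\xi>0$ the pointing error coefficient, $\alpha>0$, $\beta$ a positive integer, $g>0$, $\Omega'>0$ the Málaga turbulence parameters, $B>0$ a constant of the fading law. Put $$A=\frac{2\alpha^{\alpha/2}}{g^{1+\alpha/2}\Gamma(\alpha)}\left(\frac{g\beta}{g\beta+\Omega'}\right)^{\beta+\alpha/2},\quad a_n=\binom{\beta-1}{n-1}\frac{(g\beta+\Omega')^{1-n/2}}{(n-1)!}\left(\frac{\Omega'}{g}\right)^{n-1}\left(\frac{\alpha}{\beta}\right)^{n/2},\quad b_n=a_n\left(\frac{g\beta+\Omega'}{\alpha\beta}\right)^{\frac{\alpha+n}{2}}.$$ $\gamma_2$ is a positive random variable, independent of $\gamma_1$, with density for $x>0$ $$f_{\gamma_2}(x)=\frac{\xi^2A}{2^r x}\sum_{n=1}^{\beta}b_n\,G_{1,3}^{3,0}\left(B\left(\frac{x}{\mu_r}\right)^{1/r}\;\middle|\;\begin{matrix}\xi^2+1\\ \xi^2,\ \alpha,\ n\end{matrix}\right).$$ *)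

theory Defs
  imports "HOL-Probability.Probability" "HOL-Complex_Analysis.Complex_Analysis"
begin

definition gauss_Q :: "real \<Rightarrow> real" where
  "gauss_Q x = 1 / sqrt (2 * pi) * (LBINT t:{x..}. exp (- t\<^sup>2 / 2))"

definition Delta :: "nat \<Rightarrow> complex \<Rightarrow> complex list" where
  "Delta j x = map (\<lambda>i. (x + of_nat i) / of_nat j) [0..<j]"

text \<open>
  Meijer's G-function.  The orders \<open>p\<close> and \<open>q\<close> are the lengths of the parameter lists \<open>as\<close> and
  \<open>bs\<close>; lists are indexed from 0, so the paper-and-pencil \<open>a_j\<close> is \<open>as ! (j - 1)\<close>.
  Since \<open>Gamma\<close> is 0 at its poles and \<open>x / 0 = 0\<close>, a pole of a factor in the denominator makes
  the integrand 0, as it should.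
\<close>

definition meijer_integrand ::
  "nat \<Rightarrow> nat \<Rightarrow> complex list \<Rightarrow> complex list \<Rightarrow> complex \<Rightarrow> complex \<Rightarrow> complex" where
  "meijer_integrand m n as bs z s =
     ((\<Prod>j<m. Gamma (bs ! j + s)) * (\<Prod>j<n. Gamma (1 - as ! j - s))) /
     ((\<Prod>j=m..<length bs. Gamma (1 - bs ! j - s)) * (\<Prod>j=n..<length as. Gamma (as ! j + s)))
     * z powr (- s)"

text \<open>
  The upward line \<open>Re s = \<sigma>\<close> has all poles \<open>- b_j - k\<close> of the \<open>\<Gamma>(b_j + s)\<close> on its left and all
  poles \<open>1 - a_j + k\<close> of the \<open>\<Gamma>(1 - a_j - s)\<close> on its right.
\<close>

definition separating_line :: "nat \<Rightarrow> nat \<Rightarrow> complex list \<Rightarrow> complex list \<Rightarrow> real \<Rightarrow> bool" where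
  "separating_line m n as bs \<sigma> \<longleftrightarrow>
     (\<forall>j<m. \<forall>k::nat. Re (- (bs ! j) - of_nat k) < \<sigma>) \<and>
     (\<forall>j<n. \<forall>k::nat. \<sigma> < Re (1 - as ! j + of_nat k))"

text \<open>
  The integral is taken along a straight separating line from \<open>\<sigma> - \<i>\<infinity>\<close> to \<open>\<sigma> + \<i>\<infinity>\<close>; by Cauchy's
  theorem the choice of \<open>\<sigma>\<close> is irrelevant.  Parameters whose poles can only be separated by a
  curved contour are not covered.  They do not occur below: with \<open>n = 0\<close> any large \<open>\<sigma>\<close>
  separates, and if all \<open>b_j \<ge> 0\<close> and \<open>n = 1\<close>, \<open>a_1 = 1/2\<close>, any \<open>0 < \<sigma> < 1/2\<close> does.
\<close>

definition meijer_G ::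
  "nat \<Rightarrow> nat \<Rightarrow> complex list \<Rightarrow> complex list \<Rightarrow> complex \<Rightarrow> complex" where
  "meijer_G m n as bs z =
     (let \<sigma> = (SOME \<sigma>. separating_line m n as bs \<sigma>)
      in 1 / (2 * of_real pi * \<i>) *
         Lim at_top (\<lambda>T::real. contour_integral (linepath (Complex \<sigma> (- T)) (Complex \<sigma> T))
                                 (meijer_integrand m n as bs z)))"

definition rf_density :: "nat \<Rightarrow> nat \<Rightarrow> real \<Rightarrow> real \<Rightarrow> real \<Rightarrow> real" where
  "rf_density M m \<rho> \<mu>1 x =
     (if x \<ge> 0 then
        real m * real (M choose m) *
        (\<Sum>k<m. (-1) ^ k * real ((m - 1) choose k) /
             (((real M - real m + real k) * (1 - \<rho>) + 1) * \<mu>1) *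
             exp (- ((real M - real m + real k + 1) * x) /
                    (((real M - real m + real k) * (1 - \<rho>) + 1) * \<mu>1)))
      else 0)"

definition malaga_A :: "real \<Rightarrow> nat \<Rightarrow> real \<Rightarrow> real \<Rightarrow> real" where
  "malaga_A \<alpha> \<beta> g \<Omega> =
     2 * \<alpha> powr (\<alpha> / 2) / (g powr (1 + \<alpha> / 2) * Gamma \<alpha>) *
     (g * real \<beta> / (g * real \<beta> + \<Omega>)) powr (real \<beta> + \<alpha> / 2)"

definition malaga_a :: "real \<Rightarrow> nat \<Rightarrow> real \<Rightarrow> real \<Rightarrow> nat \<Rightarrow> real" where
  "malaga_a \<alpha> \<beta> g \<Omega> n =
     real ((\<beta> - 1) choose (n - 1)) *
     ((g * real \<beta> + \<Omega>) powr (1 - real n / 2) / fact (n - 1)) *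
     (\<Omega> / g) ^ (n - 1) * (\<alpha> / real \<beta>) powr (real n / 2)"

definition malaga_b :: "real \<Rightarrow> nat \<Rightarrow> real \<Rightarrow> real \<Rightarrow> nat \<Rightarrow> real" where
  "malaga_b \<alpha> \<beta> g \<Omega> n =
     malaga_a \<alpha> \<beta> g \<Omega> n * ((g * real \<beta> + \<Omega>) / (\<alpha> * real \<beta>)) powr ((\<alpha> + real n) / 2)"

text \<open>
  For real parameters and positive argument the G-function is real (its integrand is conjugation
  symmetric about the real axis), so \<open>Re\<close> below is only a change of type.
\<close>

definition optical_density ::
  "nat \<Rightarrow> real \<Rightarrow> real \<Rightarrow> real \<Rightarrow> nat \<Rightarrow> real \<Rightarrow> real \<Rightarrow> real \<Rightarrow> real \<Rightarrow> real" where
  "optical_density r \<mu>r \<xi> \<alpha> \<beta> g \<Omega> B x =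
     (if x > 0 then
        \<xi>\<^sup>2 * malaga_A \<alpha> \<beta> g \<Omega> / (2 ^ r * x) *
        (\<Sum>n=1..\<beta>. malaga_b \<alpha> \<beta> g \<Omega> n *
           Re (meijer_G 3 0
                 [complex_of_real (\<xi>\<^sup>2 + 1)]
                 [complex_of_real (\<xi>\<^sup>2), complex_of_real \<alpha>, of_nat n]
                 (complex_of_real (B * (x / \<mu>r) powr (1 / real r)))))
      else 0)"

definition zeta1 :: "nat \<Rightarrow> nat \<Rightarrow> real \<Rightarrow> nat \<Rightarrow> real" where
  "zeta1 M m \<rho> k =
     (real M - real m + real k + 1) / ((real M - real m + real k) * (1 - \<rho>) + 1)"

definition zeta2 :: "nat \<Rightarrow> nat \<Rightarrow> real \<Rightarrow> real \<Rightarrow> real \<Rightarrow> nat \<Rightarrow> nat \<Rightarrow> real" where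
  "zeta2 M m \<rho> C B r k =
     (real M - real m + real k + 1) * C / ((real M - real m + real k) * (1 - \<rho>) + 1) *
     (B / (real r)\<^sup>2) ^ r"

definition tau6 :: "nat \<Rightarrow> real \<Rightarrow> complex list" where
  "tau6 r \<xi> = (1 / 2) # Delta r (complex_of_real (\<xi>\<^sup>2 + 1))"

definition tau4 :: "nat \<Rightarrow> real \<Rightarrow> real \<Rightarrow> nat \<Rightarrow> complex list" where
  "tau4 r \<xi> \<alpha> n =
     Delta r (complex_of_real (\<xi>\<^sup>2)) @ Delta r (complex_of_real \<alpha>) @ Delta r (of_nat n) @ [0]"

end

theory Submission
  imports Defs
begin

text \<open>
  Conditioning on \<open>\<gamma>2 = y\<close>, the first hop contributes Laplace transforms of \<open>Q (sqrt (a x))\<close>, which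
  are elementary and leave a combination of the functions \<open>(1 + q / y) powr (-1/2)\<close>.  Writing the
  G-function in the density of \<open>\<gamma>2\<close> as an inverse Mellin transform and integrating over \<open>y\<close> first
  turns each of them into \<open>\<Gamma>(u) \<Gamma>(1/2 - u)\<close>, and Gauss' multiplication formula recognises the
  result as the integrand of the G-function of the statement.

  Two points need care.  The contour of the density's G-function is moved to the line on which the
  Mellin transform of \<open>(1 + q / y) powr (-1/2)\<close> exists.  And both densities are given only up to
  truncation at 0, so they have to be shown nonnegative: the first because its integral is 1, the
  second because \<open>\<Gamma>(\<alpha> + s) \<Gamma>(n + s) / (\<xi>\<^sup>2 + s)\<close> on a vertical line is a multiple of a
  characteristic function.
\<close>

subsection \<open>The Gamma integral and decay on vertical lines\<close>

text \<open>\<open>meijer_G\<close> picks its contour by \<open>SOME\<close>, so nothing is known of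
  the line except that it separates the poles. The G-function of the statement is therefore
  evaluated on whatever line in the strip between 0 and 1/2 happens to be chosen, and it is the
  contour in the density, free to move on the right of its poles, that is adjusted: to real part
  \<open>r * \<sigma>\<close> if the chosen line is \<open>\<sigma>\<close>. The factor
  \<open>r\<close> comes from the substitution that undoes the \<open>r\<close>-th root in the
  density, and it is what produces blocks of length \<open>r\<close>; for \<open>r = 2\<close> the
  multiplication formula is Legendre's. Convergence rests on one crude estimate, a quadratic decay
  of Gamma on vertical strips. It controls the transform of the density; integrability of the target
  integrand is then a consequence of Fubini. The RF density is a mixture of exponentials with
  weights of alternating sign, so its positivity is hidden. One binomial identity, that the weights
  sum to 1, gives both its mass and the isolated 1/2 of the result.\<close>

lemma Gamma_set_integral_complex:
  fixes z :: complex
  assumes "Re z > 0"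
  shows "set_integrable lborel {0<..} (\<lambda>t. of_real t powr (z - 1) * of_real (exp (- t)))"
    and "(LINT t:{0<..}|lborel. of_real t powr (z - 1) * of_real (exp (- t))) = Gamma z"
proof -
  let ?f = "\<lambda>t::real. complex_of_real t powr (z - 1) * of_real (exp (- t))"
  have eq: "?f = (\<lambda>t. of_real t powr (z - 1) / of_real (exp t))"
    by (auto simp: exp_minus divide_inverse)
  have ai: "?f absolutely_integrable_on {0<..}"
    using absolutely_integrable_Gamma_integral'[OF assms] unfolding eq .
  \<comment> \<open>Borel measurability lets the integral pass from the completed measure
    \<open>lebesgue\<close> to \<open>lborel\<close>, the form in which Fubini is applied
    later.\<close>
  have meas: "(\<lambda>t. indicator {0<..} t *\<^sub>R ?f t) \<in> borel_measurable lborel"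
    by measurable
  show si: "set_integrable lborel {0<..} ?f"
    using ai meas unfolding set_integrable_def by (simp add: integrable_completion)
  have "(LINT t:{0<..}|lborel. ?f t) = (LINT t:{0<..}|lebesgue. ?f t)"
    unfolding set_lebesgue_integral_def using meas by (simp add: integral_completion)
  also have "\<dots> = integral {0<..} ?f"
    using ai by (rule set_lebesgue_integral_eq_integral)
  also have "\<dots> = Gamma z"
    using Gamma_integral_complex'[OF assms] unfolding eq by (rule integral_unique)
  finally show "(LINT t:{0<..}|lborel. ?f t) = Gamma z" .
qed

lemma Gamma_set_integral_scaled:
  fixes z :: complex and v :: real
  assumes "Re z > 0" "v > 0"
  shows "set_integrable lborel {0<..} (\<lambda>t. of_real t powr (z - 1) * of_real (exp (- (v * t))))"
    and "(LINT t:{0<..}|lborel. of_real t powr (z - 1) * of_real (exp (- (v * t)))) =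
           Gamma z * of_real v powr (- z)"
proof -
  let ?f = "\<lambda>t::real. indicator {0<..} t *\<^sub>R (complex_of_real t powr (z - 1) * of_real (exp (- t)))"
  let ?g = "\<lambda>t::real. indicator {0<..} t *\<^sub>R (complex_of_real t powr (z - 1) * of_real (exp (- (v * t))))"
  have int: "integrable lborel ?f" and val: "integral\<^sup>L lborel ?f = Gamma z"
    using Gamma_set_integral_complex[OF assms(1)]
    unfolding set_integrable_def set_lebesgue_integral_def by auto
  have scale: "?f (0 + v * t) = of_real v powr (z - 1) * ?g t" for t
    using assms(2) by (cases "t > 0")
      (auto simp: powr_times_real zero_less_mult_iff indicator_def)
  have v0: "complex_of_real v powr (z - 1) \<noteq> 0" using assms(2) by simp
  have "integrable lborel (\<lambda>t. ?f (0 + v * t))"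
    using lborel_integrable_real_affine[OF int, of v 0] assms(2) by simp
  then have "integrable lborel (\<lambda>t. of_real v powr (z - 1) * ?g t)"
    unfolding scale .
  then have "integrable lborel (\<lambda>t. inverse (of_real v powr (z - 1)) * (of_real v powr (z - 1) * ?g t))"
    by (rule integrable_mult_right)
  then show "set_integrable lborel {0<..} (\<lambda>t. of_real t powr (z - 1) * of_real (exp (- (v * t))))"
    unfolding set_integrable_def using v0 by (simp add: mult.assoc[symmetric])
  have "Gamma z = \<bar>v\<bar> *\<^sub>R (\<integral>t. ?f (0 + v * t) \<partial>lborel)"
    unfolding val[symmetric] by (rule lborel_integral_real_affine) (use assms in auto)
  also have "\<dots> = of_real v * (of_real v powr (z - 1) * integral\<^sup>L lborel ?g)"
    unfolding scale using assms(2) by (simp add: scaleR_conv_of_real)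
  also have "\<dots> = of_real v powr z * integral\<^sup>L lborel ?g"
    using assms(2) by (simp add: powr_diff mult.assoc[symmetric])
  finally show "(LINT t:{0<..}|lborel. of_real t powr (z - 1) * of_real (exp (- (v * t)))) =
           Gamma z * of_real v powr (- z)"
    unfolding set_lebesgue_integral_def using assms(2) by (simp add: powr_minus field_simps)
qed

text \<open>The triangle inequality in Euler's integral: for \<open>t > 0\<close> the modulus of
  \<open>t powr (z - 1)\<close> depends on \<open>Re z\<close> only.\<close>

lemma norm_Gamma_le_Gamma_Re:
  fixes z :: complex
  assumes "Re z > 0"
  shows "norm (Gamma z) \<le> Gamma (Re z)"
proof -
  let ?f = "\<lambda>z t. indicator {0<..} t *\<^sub>R (complex_of_real t powr (z - 1) * of_real (exp (- t)))"
  have val: "integral\<^sup>L lborel (?f z) = Gamma z" if "Re z > 0" for z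
    using Gamma_set_integral_complex(2)[OF that] unfolding set_lebesgue_integral_def .
  have nrm: "norm (?f z t) = Re (?f (of_real (Re z)) t)" for t
  proof (cases "t > 0")
    case True
    have "complex_of_real t powr (of_real (Re z) - 1) = of_real (t powr (Re z - 1))"
      using True powr_of_real[of t "Re z - 1"] by simp
    then show ?thesis using True by (simp add: norm_mult norm_powr_real_powr)
  qed simp
  have int: "integrable lborel (?f (of_real (Re z)))"
    using Gamma_set_integral_complex(1)[of "of_real (Re z)"] assms unfolding set_integrable_def by simp
  have "norm (Gamma z) \<le> (\<integral>t. norm (?f z t) \<partial>lborel)"
    unfolding val[OF assms, symmetric] by (rule integral_norm_bound)
  also have "\<dots> = Re (integral\<^sup>L lborel (?f (of_real (Re z))))"
    unfolding nrm using int by (rule integral_Re)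
  also have "\<dots> = Gamma (Re z)"
    using val[of "of_real (Re z)"] assms by (simp add: Gamma_complex_of_real)
  finally show ?thesis .
qed

text \<open>By \<open>norm_Gamma_le_Gamma_Re\<close> a strip, unbounded in the imaginary direction,
  reduces to the compact interval of its real parts.\<close>

lemma Gamma_bounded_strip:
  assumes "0 < x1"
  obtains K where "K \<ge> 0" "\<And>z::complex. x1 \<le> Re z \<Longrightarrow> Re z \<le> x2 \<Longrightarrow> norm (Gamma z) \<le> K"
proof -
  have "continuous_on {x1..x2} (Gamma :: real \<Rightarrow> real)"
    using assms by (intro continuous_on_Gamma continuous_on_id) auto
  then have "bounded (Gamma ` {x1..x2})"
    by (intro compact_imp_bounded compact_continuous_image) auto
  then obtain K where K: "\<And>x. x \<in> {x1..x2} \<Longrightarrow> norm (Gamma x) \<le> K"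
    unfolding bounded_iff by blast
  show ?thesis
  proof (rule that[of "max K 0"])
    fix z :: complex assume z: "x1 \<le> Re z" "Re z \<le> x2"
    have "norm (Gamma z) \<le> Gamma (Re z)" using z assms by (intro norm_Gamma_le_Gamma_Re) auto
    also have "\<dots> \<le> K" using K[of "Re z"] z by auto
    finally show "norm (Gamma z) \<le> max K 0" by simp
  qed auto
qed

lemma nonpos_Ints_Re_le_0: "z \<in> \<int>\<^sub>\<le>\<^sub>0 \<Longrightarrow> Re z \<le> 0"
  by (auto elim!: nonpos_Ints_cases)

text \<open>Two applications of the functional equation express \<open>Gamma z\<close> as the
  bounded \<open>Gamma (z + 2)\<close> over \<open>z * (z + 1)\<close>. Two shifts give just the
  quadratic rate that makes vertical lines integrable; the true decay is exponential, but would call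
  for asymptotics.\<close>

lemma Gamma_decay_strip:
  assumes "0 < x1"
  obtains K where "K \<ge> 0"
    "\<And>z::complex. x1 \<le> Re z \<Longrightarrow> Re z \<le> x2 \<Longrightarrow> norm (Gamma z) \<le> K / (1 + (Im z)\<^sup>2)"
proof -
  obtain K where K: "K \<ge> 0"
    "\<And>z::complex. x1 + 2 \<le> Re z \<Longrightarrow> Re z \<le> x2 + 2 \<Longrightarrow> norm (Gamma z) \<le> K"
    using Gamma_bounded_strip[of "x1 + 2" "x2 + 2"] assms by auto
  show ?thesis
  proof (rule that[of "K * (1 + 1 / x1\<^sup>2)"])
    fix z :: complex assume z: "x1 \<le> Re z" "Re z \<le> x2"
    have Rez: "Re z > 0" "Re (z + 1) > 0" using z assms by auto
    have nz: "z \<notin> \<int>\<^sub>\<le>\<^sub>0" "z + 1 \<notin> \<int>\<^sub>\<le>\<^sub>0"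
      using Rez nonpos_Ints_Re_le_0 by (meson not_le)+
    have sq: "norm z ^ 2 = (Re z)\<^sup>2 + (Im z)\<^sup>2"
      by (simp add: cmod_power2)
    have le: "norm z \<le> norm (z + 1)"
      unfolding cmod_def using z assms by (auto intro!: power_mono)
    have "Gamma (z + 2) = z * (z + 1) * Gamma z"
      using Gamma_plus1[OF nz(1)] Gamma_plus1[OF nz(2)] by (simp add: add.assoc)
    then have "norm z * norm (z + 1) * norm (Gamma z) = norm (Gamma (z + 2))"
      by (simp add: norm_mult)
    also have "\<dots> \<le> K" using z by (intro K) auto
    finally have "norm z * norm (z + 1) * norm (Gamma z) \<le> K" .
    moreover have "norm z ^ 2 * norm (Gamma z) \<le> norm z * norm (z + 1) * norm (Gamma z)"
      unfolding power2_eq_square using le by (intro mult_right_mono mult_left_mono) auto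
    ultimately have 1: "norm z ^ 2 * norm (Gamma z) \<le> K" by linarith
    \<comment> \<open>\<open>x1 \<le> norm z\<close> pays for the 1 in
      \<open>1 + (Im z)\<^sup>2\<close>, and \<open>\<bar>Im z\<bar> \<le> norm z\<close> for the
      square; together they give the factor \<open>1 + 1 / x1\<^sup>2\<close>.\<close>
    have x1: "x1\<^sup>2 \<le> norm z ^ 2"
      using power_mono[of x1 "Re z" 2] z assms unfolding sq by (simp add: add_increasing2)
    have "1 \<le> norm z ^ 2 / x1\<^sup>2" using x1 assms by (simp add: field_simps)
    moreover have "(Im z)\<^sup>2 \<le> norm z ^ 2" unfolding sq by simp
    ultimately have "1 + (Im z)\<^sup>2 \<le> norm z ^ 2 * (1 + 1 / x1\<^sup>2)"
      by (simp add: field_simps)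
    then have "norm (Gamma z) * (1 + (Im z)\<^sup>2) \<le> norm (Gamma z) * (norm z ^ 2 * (1 + 1 / x1\<^sup>2))"
      by (intro mult_left_mono) auto
    also have "\<dots> \<le> K * (1 + 1 / x1\<^sup>2)"
      using mult_right_mono[OF 1, of "1 + 1 / x1\<^sup>2"] by (simp add: mult_ac)
    finally show "norm (Gamma z) \<le> K * (1 + 1 / x1\<^sup>2) / (1 + (Im z)\<^sup>2)"
      by (subst pos_le_divide_eq) (auto simp: add_pos_nonneg)
  qed (use K in auto)
qed

lemma integrable_divide_1_plus_square: "integrable lborel (\<lambda>t::real. K / (1 + t\<^sup>2))"
proof -
  have "integrable lborel (\<lambda>t::real. inverse (1 + t\<^sup>2))"
    using integrable_inverse_1_plus_square unfolding set_integrable_def by (simp add: einterval_eq)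
  from integrable_mult_right[OF this, of K] show ?thesis by (simp add: divide_inverse)
qed

subsection \<open>Meijer G-functions as line integrals\<close>

text \<open>The \<open>Lim\<close> in \<open>meijer_G\<close> is a symmetric improper integral; for
  an absolutely integrable integrand, dominated convergence makes it a Lebesgue integral over the
  line. The factor \<open>\<i>\<close> is the derivative of the parametrisation.\<close>

lemma tendsto_contour_integral_vertical_line:
  fixes f :: "complex \<Rightarrow> complex"
  assumes cont: "continuous_on UNIV (\<lambda>t. f (Complex \<sigma> t))"
    and int: "integrable lborel (\<lambda>t. f (Complex \<sigma> t))"
  shows "((\<lambda>T. contour_integral (linepath (Complex \<sigma> (- T)) (Complex \<sigma> T)) f)
           \<longlongrightarrow> \<i> * (\<integral>t. f (Complex \<sigma> t) \<partial>lborel)) at_top"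
proof -
  let ?g = "\<lambda>t. f (Complex \<sigma> t)"
  have "contour_integral (linepath (Complex \<sigma> (- T)) (Complex \<sigma> T)) f =
          \<i> * (\<integral>t. indicator {-T..T} t *\<^sub>R ?g t \<partial>lborel)" if "T > 0" for T
  proof -
    have "contour_integral (linepath (Complex \<sigma> (- T)) (Complex \<sigma> T)) f = \<i> * integral {-T..T} ?g"
      by (rule contour_integral_linepath_same_Re) (use that in auto)
    also have "set_integrable lborel {-T..T} ?g"
      by (rule borel_integrable_atLeastAtMost') (rule continuous_on_subset[OF cont], simp)
    from set_borel_integral_eq_integral(2)[OF this]
    have "integral {-T..T} ?g = (\<integral>t. indicator {-T..T} t *\<^sub>R ?g t \<partial>lborel)"
      by (simp add: set_lebesgue_integral_def)
    finally show ?thesis .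
  qed
  then have ev: "eventually (\<lambda>T. \<i> * (\<integral>t. indicator {-T..T} t *\<^sub>R ?g t \<partial>lborel) =
      contour_integral (linepath (Complex \<sigma> (- T)) (Complex \<sigma> T)) f) at_top"
    by (intro eventually_mono[OF eventually_gt_at_top[of 0]]) auto
  have "((\<lambda>T. \<integral>t. indicator {-T..T} t *\<^sub>R ?g t \<partial>lborel) \<longlongrightarrow> (\<integral>t. ?g t \<partial>lborel)) at_top"
  proof (rule integral_dominated_convergence_at_top[where w = "\<lambda>t. norm (?g t)"])
    show "\<forall>\<^sub>F T in at_top. AE t in lborel. norm (indicator {-T..T} t *\<^sub>R ?g t) \<le> norm (?g t)"
      by (intro always_eventually allI AE_I2) (auto simp: indicator_def)
    show "AE t in lborel. ((\<lambda>T. indicator {-T..T} t *\<^sub>R ?g t) \<longlongrightarrow> ?g t) at_top"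
    proof (rule AE_I2)
      fix t :: real
      have "eventually (\<lambda>T. ?g t = indicator {-T..T} t *\<^sub>R ?g t) at_top"
        using eventually_ge_at_top[of "\<bar>t\<bar>"]
        by eventually_elim (auto simp: indicator_def)
      then show "((\<lambda>T. indicator {-T..T} t *\<^sub>R ?g t) \<longlongrightarrow> ?g t) at_top"
        by (rule Lim_transform_eventually[OF tendsto_const])
    qed
  qed (use int in \<open>auto intro: integrable_norm\<close>)
  then show ?thesis
    by (intro Lim_transform_eventually[OF _ ev] tendsto_mult_left)
qed

text \<open>Cauchy's theorem for a tall rectangle, in the form that \<open>f\<close> has a primitive
  on a convex half-plane containing both lines. The quadratic bound kills the horizontal edges and
  makes the vertical integrals absolutely convergent.\<close>

lemma vertical_line_integral_shift:
  fixes f :: "complex \<Rightarrow> complex"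
  assumes hol: "f holomorphic_on {s. l < Re s}"
    and "l < \<sigma>1" "\<sigma>1 \<le> \<sigma>2"
    and bound: "\<And>s. \<sigma>1 \<le> Re s \<Longrightarrow> Re s \<le> \<sigma>2 \<Longrightarrow> norm (f s) \<le> K / (1 + (Im s)\<^sup>2)"
  shows "(\<integral>t. f (Complex \<sigma>1 t) \<partial>lborel) = (\<integral>t. f (Complex \<sigma>2 t) \<partial>lborel)"
proof -
  let ?S = "{s. l < Re s}"
  have S: "convex ?S" "open ?S"
    by (simp_all add: convex_halfspace_Re_gt open_halfspace_Re_gt)
  obtain F where F: "\<And>s. s \<in> ?S \<Longrightarrow> (F has_field_derivative f s) (at s within ?S)"
    using holomorphic_convex_primitive'[OF S hol] by blast
  have prim: "contour_integral (linepath a b) f = F b - F a" if "a \<in> ?S" "b \<in> ?S" for a b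
  proof -
    have "closed_segment a b \<subseteq> ?S" using that S(1) by (rule closed_segment_subset)
    then show ?thesis
      using contour_integral_primitive[of ?S F f "linepath a b"] F
      by (intro contour_integral_unique) auto
  qed
  have contf: "continuous_on ?S f"
    using hol by (rule holomorphic_on_imp_continuous_on)
  have vert: "((\<lambda>T. contour_integral (linepath (Complex \<sigma> (- T)) (Complex \<sigma> T)) f)
           \<longlongrightarrow> \<i> * (\<integral>t. f (Complex \<sigma> t) \<partial>lborel)) at_top"
    if \<sigma>: "\<sigma>1 \<le> \<sigma>" "\<sigma> \<le> \<sigma>2" for \<sigma>
  proof (rule tendsto_contour_integral_vertical_line)
    show cont: "continuous_on UNIV (\<lambda>t. f (Complex \<sigma> t))"
      by (rule continuous_on_compose2[OF contf])
         (use \<sigma> assms(2) in \<open>auto intro!: continuous_intros simp: Complex_eq\<close>)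
    show "integrable lborel (\<lambda>t. f (Complex \<sigma> t))"
    proof (rule Bochner_Integration.integrable_bound[OF integrable_divide_1_plus_square[of K]])
      show "(\<lambda>t. f (Complex \<sigma> t)) \<in> borel_measurable lborel"
        using borel_measurable_continuous_onI[OF cont] by simp
      show "AE t in lborel. norm (f (Complex \<sigma> t)) \<le> norm (K / (1 + t\<^sup>2))"
        unfolding real_norm_def using bound[of "Complex \<sigma> t" for t] \<sigma>
        by (intro AE_I2 order_trans[OF _ abs_ge_self]) auto
    qed
  qed
  \<comment> \<open>\<open>h\<close> is 1 for the upper edge and -1 for the lower one.\<close>
  have hor: "((\<lambda>T. contour_integral (linepath (Complex \<sigma>1 (h * T)) (Complex \<sigma>2 (h * T))) f) \<longlongrightarrow> 0) at_top"
    if "\<bar>h\<bar> = 1" for h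
  proof (rule tendsto_0_le[where K = 1])
    show "((\<lambda>T. K / (1 + T\<^sup>2) * (\<sigma>2 - \<sigma>1)) \<longlongrightarrow> 0) at_top"
      by real_asymp
    show "\<forall>\<^sub>F T in at_top. norm (contour_integral (linepath (Complex \<sigma>1 (h * T)) (Complex \<sigma>2 (h * T))) f)
             \<le> norm (K / (1 + T\<^sup>2) * (\<sigma>2 - \<sigma>1)) * 1"
    proof (intro always_eventually allI)
      fix T :: real
      let ?a = "Complex \<sigma>1 (h * T)" and ?b = "Complex \<sigma>2 (h * T)"
      have h2: "(h * T)\<^sup>2 = T\<^sup>2"
        using that by (simp add: power_mult_distrib power2_eq_1_iff abs_if split: if_splits)
      have seg: "closed_segment ?a ?b \<subseteq> {s. \<sigma>1 \<le> Re s \<and> Re s \<le> \<sigma>2 \<and> Im s = h * T}"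
        using assms(3) by (auto simp: closed_segment_same_Im closed_segment_eq_real_ivl)
      have "?a \<in> ?S" "?b \<in> ?S" using assms(2,3) by auto
      then have sub: "closed_segment ?a ?b \<subseteq> ?S" using S(1) by (rule closed_segment_subset)
      have "f contour_integrable_on linepath ?a ?b"
        by (rule contour_integrable_continuous_linepath) (rule continuous_on_subset[OF contf sub])
      \<comment> \<open>The sign is read off the bound at the corner \<open>?a\<close>.\<close>
      moreover have K: "0 \<le> K / (1 + T\<^sup>2)"
        using bound[of ?a] assms(3) h2 by (metis complex.sel norm_ge_zero order.trans order_refl)
      moreover have "norm (f x) \<le> K / (1 + T\<^sup>2)" if "x \<in> closed_segment ?a ?b" for x
        using bound[of x] seg that h2 by auto
      ultimately have "norm (contour_integral (linepath ?a ?b) f) \<le> K / (1 + T\<^sup>2) * norm (?b - ?a)"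
        by (intro contour_integral_bound_linepath) auto
      also have "norm (?b - ?a) = \<sigma>2 - \<sigma>1"
        using assms(3) by (simp add: cmod_def)
      finally show "norm (contour_integral (linepath ?a ?b) f) \<le> norm (K / (1 + T\<^sup>2) * (\<sigma>2 - \<sigma>1)) * 1"
        unfolding real_norm_def mult_1_right by (rule order_trans[OF _ abs_ge_self])
    qed
  qed
  \<comment> \<open>Both sides are the same combination of the values of the primitive at the four
    corners.\<close>
  have eq: "contour_integral (linepath (Complex \<sigma>2 (- T)) (Complex \<sigma>2 T)) f -
      contour_integral (linepath (Complex \<sigma>1 (- T)) (Complex \<sigma>1 T)) f =
      contour_integral (linepath (Complex \<sigma>1 (1 * T)) (Complex \<sigma>2 (1 * T))) f -
      contour_integral (linepath (Complex \<sigma>1 (-1 * T)) (Complex \<sigma>2 (-1 * T))) f" for T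
    using assms(2,3) by (simp add: prim)
  have "((\<lambda>T. contour_integral (linepath (Complex \<sigma>2 (- T)) (Complex \<sigma>2 T)) f -
      contour_integral (linepath (Complex \<sigma>1 (- T)) (Complex \<sigma>1 T)) f) \<longlongrightarrow> 0 - 0) at_top"
    unfolding eq by (intro tendsto_diff hor) auto
  moreover have "((\<lambda>T. contour_integral (linepath (Complex \<sigma>2 (- T)) (Complex \<sigma>2 T)) f -
      contour_integral (linepath (Complex \<sigma>1 (- T)) (Complex \<sigma>1 T)) f) \<longlongrightarrow>
      \<i> * (\<integral>t. f (Complex \<sigma>2 t) \<partial>lborel) - \<i> * (\<integral>t. f (Complex \<sigma>1 t) \<partial>lborel)) at_top"
    using assms(3) by (intro tendsto_diff vert) auto
  ultimately have "\<i> * (\<integral>t. f (Complex \<sigma>2 t) \<partial>lborel) - \<i> * (\<integral>t. f (Complex \<sigma>1 t) \<partial>lborel) = 0 - 0"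
    by (intro tendsto_unique[OF trivial_limit_at_top_linorder])
  then show ?thesis by simp
qed

text \<open>\<open>SOME\<close> reveals nothing about the chosen line, so the premises range over
  all separating lines and the conclusion hands back an unspecified one.\<close>

lemma meijer_G_eq_line_integral:
  assumes "separating_line m n as bs \<sigma>0"
    and "\<And>\<sigma>. separating_line m n as bs \<sigma> \<Longrightarrow>
           continuous_on UNIV (\<lambda>t. meijer_integrand m n as bs z (Complex \<sigma> t))"
    and "\<And>\<sigma>. separating_line m n as bs \<sigma> \<Longrightarrow>
           integrable lborel (\<lambda>t. meijer_integrand m n as bs z (Complex \<sigma> t))"
  obtains \<sigma> where "separating_line m n as bs \<sigma>"
    "meijer_G m n as bs z = 1 / (2 * of_real pi) * (\<integral>t. meijer_integrand m n as bs z (Complex \<sigma> t) \<partial>lborel)"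
proof
  let ?\<sigma> = "SOME \<sigma>. separating_line m n as bs \<sigma>"
  show sep: "separating_line m n as bs ?\<sigma>"
    using assms(1) by (rule someI)
  have "Lim at_top (\<lambda>T::real. contour_integral (linepath (Complex ?\<sigma> (- T)) (Complex ?\<sigma> T))
           (meijer_integrand m n as bs z)) =
        \<i> * (\<integral>t. meijer_integrand m n as bs z (Complex ?\<sigma> t) \<partial>lborel)"
    by (intro tendsto_Lim tendsto_contour_integral_vertical_line assms(2,3) sep) auto
  then show "meijer_G m n as bs z =
      1 / (2 * of_real pi) * (\<integral>t. meijer_integrand m n as bs z (Complex ?\<sigma> t) \<partial>lborel)"
    by (simp add: meijer_G_def Let_def)
qed

section \<open>The Mellin transform of the G-function in the optical density\<close>

definition malaga_mellin :: "real \<Rightarrow> real \<Rightarrow> real \<Rightarrow> complex \<Rightarrow> complex" where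
  "malaga_mellin w \<alpha> \<nu> s = Gamma (of_real \<alpha> + s) * Gamma (of_real \<nu> + s) / (of_real w + s)"

text \<open>The functional equation collapses the numerator factor at \<open>w\<close> and the
  denominator factor at \<open>w + 1\<close> to \<open>1 / (w + s)\<close>. In this form the growth
  of the transform is plain, and so is its probabilistic meaning.\<close>

lemma meijer_integrand_3_0:
  assumes "Re s > - w"
  shows "meijer_integrand 3 0 [of_real (w + 1)] [of_real w, of_real \<alpha>, of_real \<nu>] z s =
           malaga_mellin w \<alpha> \<nu> s * z powr (- s)"
proof -
  have pos: "Re (of_real w + s) > 0" using assms by simp
  then have nz: "of_real w + s \<notin> \<int>\<^sub>\<le>\<^sub>0" using nonpos_Ints_Re_le_0 by (meson not_le)
  have "Gamma (of_real (w + 1) + s) = (of_real w + s) * Gamma (of_real w + s)"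
    using Gamma_plus1[OF nz] by (simp add: add_ac)
  moreover have "Gamma (of_real w + s) \<noteq> 0"
    using nz by (simp add: Gamma_eq_zero_iff)
  ultimately have "Gamma (of_real w + s) / Gamma (of_real (w + 1) + s) = 1 / (of_real w + s)"
    by simp
  moreover have "meijer_integrand 3 0 [of_real (w + 1)] [of_real w, of_real \<alpha>, of_real \<nu>] z s =
      Gamma (of_real w + s) / Gamma (of_real (w + 1) + s) *
      (Gamma (of_real \<alpha> + s) * Gamma (of_real \<nu> + s)) * z powr (- s)"
    by (simp add: meijer_integrand_def numeral_3_eq_3 mult_ac del: of_real_add)
  ultimately show ?thesis
    by (simp add: malaga_mellin_def)
qed

text \<open>An equivalence, because the line chosen by \<open>SOME\<close> is known only through
  this predicate. The rightmost poles, those with \<open>k = 0\<close>, decide; nothing bounds the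
  line on the right.\<close>

lemma separating_line_3_0:
  "separating_line 3 0 [of_real (w + 1)] [of_real w, of_real \<alpha>, of_real \<nu>] \<sigma> \<longleftrightarrow>
     - w < \<sigma> \<and> - \<alpha> < \<sigma> \<and> - \<nu> < \<sigma>"
proof
  assume L: "separating_line 3 0 [of_real (w + 1)] [of_real w, of_real \<alpha>, of_real \<nu>] \<sigma>"
  have "Re (- ([of_real w, of_real \<alpha>, of_real \<nu>] ! j :: complex) - of_nat 0) < \<sigma>" if "j < 3" for j
    using L that unfolding separating_line_def by blast
  from this[of 0] this[of 1] this[of 2] show "- w < \<sigma> \<and> - \<alpha> < \<sigma> \<and> - \<nu> < \<sigma>"
    by simp
next
  assume R: "- w < \<sigma> \<and> - \<alpha> < \<sigma> \<and> - \<nu> < \<sigma>"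
  have "Re (- ([of_real w, of_real \<alpha>, of_real \<nu>] ! j :: complex) - of_nat k) < \<sigma>" if "j < 3" for j k
    using that R by (auto simp: numeral_3_eq_3 less_Suc_eq)
  then show "separating_line 3 0 [of_real (w + 1)] [of_real w, of_real \<alpha>, of_real \<nu>] \<sigma>"
    unfolding separating_line_def by blast
qed

text \<open>One Gamma factor supplies the quadratic decay, boundedness of the other is enough, and
  the denominator stays at distance at least \<open>w + x1\<close> from 0.\<close>

lemma malaga_mellin_decay:
  assumes "- w < x1" "- \<alpha> < x1" "- \<nu> < x1"
  obtains K where "K \<ge> 0"
    "\<And>s. x1 \<le> Re s \<Longrightarrow> Re s \<le> x2 \<Longrightarrow> norm (malaga_mellin w \<alpha> \<nu> s) \<le> K / (1 + (Im s)\<^sup>2)"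
proof -
  obtain K1 where K1: "K1 \<ge> 0" "\<And>z::complex. \<alpha> + x1 \<le> Re z \<Longrightarrow> Re z \<le> \<alpha> + x2 \<Longrightarrow>
      norm (Gamma z) \<le> K1 / (1 + (Im z)\<^sup>2)"
    using Gamma_decay_strip[of "\<alpha> + x1" "\<alpha> + x2"] assms by auto
  obtain K2 where K2: "K2 \<ge> 0" "\<And>z::complex. \<nu> + x1 \<le> Re z \<Longrightarrow> Re z \<le> \<nu> + x2 \<Longrightarrow> norm (Gamma z) \<le> K2"
    using Gamma_bounded_strip[of "\<nu> + x1" "\<nu> + x2"] assms by auto
  show ?thesis
  proof (rule that[of "K1 * K2 / (w + x1)"])
    show "0 \<le> K1 * K2 / (w + x1)" using K1 K2 assms by auto
    fix s :: complex assume s: "x1 \<le> Re s" "Re s \<le> x2"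
    have "w + x1 \<le> Re (of_real w + s)" using s by simp
    also have "\<dots> \<le> norm (of_real w + s)" by (rule complex_Re_le_cmod)
    finally have 3: "w + x1 \<le> norm (of_real w + s)" .
    have "norm (malaga_mellin w \<alpha> \<nu> s) =
        norm (Gamma (of_real \<alpha> + s)) * norm (Gamma (of_real \<nu> + s)) / norm (of_real w + s)"
      by (simp add: malaga_mellin_def norm_mult norm_divide)
    also have "\<dots> \<le> K1 / (1 + (Im s)\<^sup>2) * K2 / (w + x1)"
      using s K1(1) K2(1) K1(2)[of "of_real \<alpha> + s"] K2(2)[of "of_real \<nu> + s"] assms 3
      by (intro frac_le mult_mono mult_nonneg_nonneg divide_nonneg_nonneg) (auto simp: add_nonneg_nonneg)
    finally show "norm (malaga_mellin w \<alpha> \<nu> s) \<le> K1 * K2 / (w + x1) / (1 + (Im s)\<^sup>2)"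
      by (simp add: mult_ac)
  qed
qed

lemma malaga_mellin_holomorphic:
  assumes "- w \<le> x0" "- \<alpha> \<le> x0" "- \<nu> \<le> x0"
  shows "malaga_mellin w \<alpha> \<nu> holomorphic_on {s. x0 < Re s}"
proof -
  have nz: "of_real a + s \<notin> \<int>\<^sub>\<le>\<^sub>0" if "x0 < Re s" "- a \<le> x0" for a s
    using nonpos_Ints_Re_le_0[of "of_real a + s"] that by auto
  show ?thesis
    unfolding malaga_mellin_def using assms nz
    by (intro holomorphic_intros) (auto simp: complex_eq_iff)
qed

lemma continuous_on_malaga_mellin_line:
  assumes "- w < \<sigma>" "- \<alpha> < \<sigma>" "- \<nu> < \<sigma>"
  shows "continuous_on UNIV (\<lambda>t. malaga_mellin w \<alpha> \<nu> (Complex \<sigma> t))"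
proof -
  define x0 where "x0 = Max {- w, - \<alpha>, - \<nu>}"
  have "continuous_on {s. x0 < Re s} (malaga_mellin w \<alpha> \<nu>)"
    by (intro holomorphic_on_imp_continuous_on malaga_mellin_holomorphic) (auto simp: x0_def)
  then show ?thesis
    by (rule continuous_on_compose2)
       (use assms in \<open>auto intro!: continuous_intros simp: Complex_eq x0_def\<close>)
qed

lemma integrable_malaga_mellin_line:
  assumes "- w < \<sigma>" "- \<alpha> < \<sigma>" "- \<nu> < \<sigma>"
  shows "integrable lborel (\<lambda>t. malaga_mellin w \<alpha> \<nu> (Complex \<sigma> t))"
proof -
  obtain K where K: "K \<ge> 0"
    "\<And>s. \<sigma> \<le> Re s \<Longrightarrow> Re s \<le> \<sigma> \<Longrightarrow> norm (malaga_mellin w \<alpha> \<nu> s) \<le> K / (1 + (Im s)\<^sup>2)"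
    using malaga_mellin_decay[OF assms] by blast
  show ?thesis
  proof (rule Bochner_Integration.integrable_bound[OF integrable_divide_1_plus_square[of K]])
    show "(\<lambda>t. malaga_mellin w \<alpha> \<nu> (Complex \<sigma> t)) \<in> borel_measurable lborel"
      using borel_measurable_continuous_onI[OF continuous_on_malaga_mellin_line[OF assms]] by simp
    show "AE t in lborel. norm (malaga_mellin w \<alpha> \<nu> (Complex \<sigma> t)) \<le> norm (K / (1 + t\<^sup>2))"
      unfolding real_norm_def using K(2)[of "Complex \<sigma> t" for t]
      by (intro AE_I2 order_trans[OF _ abs_ge_self]) auto
  qed
qed

text \<open>The freedom of \<open>\<sigma>\<close> is the point: the unknown line of
  \<open>meijer_G\<close> is exchanged for any line right of the poles, later the imaginary axis for
  positivity and the line \<open>r * \<sigma>\<close> for the convolution.\<close>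

lemma meijer_G_3_0_eq:
  assumes "z > 0" "- w < \<sigma>" "- \<alpha> < \<sigma>" "- \<nu> < \<sigma>"
  shows "meijer_G 3 0 [of_real (w + 1)] [of_real w, of_real \<alpha>, of_real \<nu>] (of_real z) =
    1 / (2 * of_real pi) *
    (\<integral>t. malaga_mellin w \<alpha> \<nu> (Complex \<sigma> t) * of_real z powr (- Complex \<sigma> t) \<partial>lborel)"
proof -
  let ?a = "[of_real (w + 1)] :: complex list" and ?b = "[of_real w, of_real \<alpha>, of_real \<nu>] :: complex list"
  let ?f = "\<lambda>s. malaga_mellin w \<alpha> \<nu> s * of_real z powr (- s)"
  have eq: "meijer_integrand 3 0 ?a ?b (of_real z) (Complex \<sigma> t) = ?f (Complex \<sigma> t)"
    if "- w < \<sigma>" for \<sigma> t using that by (intro meijer_integrand_3_0) simp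
  have cont: "continuous_on UNIV (\<lambda>t. ?f (Complex \<sigma> t))"
    if "- w < \<sigma>" "- \<alpha> < \<sigma>" "- \<nu> < \<sigma>" for \<sigma>
    using assms(1) by (intro continuous_intros continuous_on_malaga_mellin_line that)
      (auto intro!: continuous_intros simp: Complex_eq)
  have int: "integrable lborel (\<lambda>t. ?f (Complex \<sigma> t))"
    if \<sigma>: "- w < \<sigma>" "- \<alpha> < \<sigma>" "- \<nu> < \<sigma>" for \<sigma>
  proof (rule Bochner_Integration.integrable_bound[OF integrable_mult_left[OF
        integrable_norm[OF integrable_malaga_mellin_line[OF \<sigma>]], of "z powr (- \<sigma>)"]])
    show "(\<lambda>t. ?f (Complex \<sigma> t)) \<in> borel_measurable lborel"
      using borel_measurable_continuous_onI[OF cont[OF \<sigma>]] by simp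
  qed (use assms(1) in \<open>auto simp: norm_mult norm_powr_real_powr\<close>)
  have sep: "separating_line 3 0 ?a ?b \<sigma>" using assms by (simp only: separating_line_3_0)
  obtain \<sigma>1 where \<sigma>1: "separating_line 3 0 ?a ?b \<sigma>1"
    and G: "meijer_G 3 0 ?a ?b (of_real z) = 1 / (2 * of_real pi) *
      (\<integral>t. meijer_integrand 3 0 ?a ?b (of_real z) (Complex \<sigma>1 t) \<partial>lborel)"
  proof (rule meijer_G_eq_line_integral[OF sep])
    fix \<sigma> assume "separating_line 3 0 ?a ?b \<sigma>"
    then have \<sigma>: "- w < \<sigma>" "- \<alpha> < \<sigma>" "- \<nu> < \<sigma>" by (auto simp only: separating_line_3_0)
    show "continuous_on UNIV (\<lambda>t. meijer_integrand 3 0 ?a ?b (of_real z) (Complex \<sigma> t))"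
      unfolding eq[OF \<sigma>(1)] by (rule cont[OF \<sigma>])
    show "integrable lborel (\<lambda>t. meijer_integrand 3 0 ?a ?b (of_real z) (Complex \<sigma> t))"
      unfolding eq[OF \<sigma>(1)] by (rule int[OF \<sigma>])
  qed
  have \<sigma>1': "- w < \<sigma>1" "- \<alpha> < \<sigma>1" "- \<nu> < \<sigma>1"
    using \<sigma>1 by (auto simp only: separating_line_3_0)
  have shift: "(\<integral>t. ?f (Complex a t) \<partial>lborel) = (\<integral>t. ?f (Complex b t) \<partial>lborel)"
    if a: "- w < a" "- \<alpha> < a" "- \<nu> < a" and ab: "a \<le> b" for a b
  proof -
    obtain K where K: "K \<ge> 0"
      "\<And>s. a \<le> Re s \<Longrightarrow> Re s \<le> b \<Longrightarrow> norm (malaga_mellin w \<alpha> \<nu> s) \<le> K / (1 + (Im s)\<^sup>2)"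
      using malaga_mellin_decay[OF a] by blast
    \<comment> \<open>\<open>z powr (- x)\<close> is monotone in \<open>x\<close>, with a direction
      that depends on whether \<open>z \<ge> 1\<close>; the sum of its two end values covers both
      cases.\<close>
    define Z where "Z = z powr (- a) + z powr (- b)"
    have Z: "z powr (- x) \<le> Z" if "a \<le> x" "x \<le> b" for x
    proof (cases "z \<ge> 1")
      case True
      then have "z powr (- x) \<le> z powr (- a)" using that by (intro powr_mono) auto
      then show ?thesis by (simp add: Z_def add_increasing2)
    next
      case False
      then have "z powr (- x) \<le> z powr (- b)" using that assms(1) by (intro powr_mono') auto
      then show ?thesis by (simp add: Z_def add_increasing)
    qed
    define x0 where "x0 = Max {- w, - \<alpha>, - \<nu>}"
    show ?thesis
    proof (rule vertical_line_integral_shift[where l = x0 and K = "K * Z"])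
      show "?f holomorphic_on {s. x0 < Re s}"
        using assms(1) by (intro holomorphic_intros malaga_mellin_holomorphic) (auto simp: x0_def)
      show "x0 < a" using a by (auto simp: x0_def)
      fix s assume s: "a \<le> Re s" "Re s \<le> b"
      have "norm (?f s) = norm (malaga_mellin w \<alpha> \<nu> s) * z powr (- Re s)"
        using assms(1) by (simp add: norm_mult norm_powr_real_powr)
      also have "\<dots> \<le> K / (1 + (Im s)\<^sup>2) * Z"
        using K s Z by (intro mult_mono) (auto intro!: divide_nonneg_nonneg)
      finally show "norm (?f s) \<le> K * Z / (1 + (Im s)\<^sup>2)" by simp
    qed (use ab in auto)
  qed
  have "(\<integral>t. ?f (Complex \<sigma>1 t) \<partial>lborel) = (\<integral>t. ?f (Complex \<sigma> t) \<partial>lborel)"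
  proof (cases "\<sigma>1 \<le> \<sigma>")
    case True
    then show ?thesis by (rule shift[OF \<sigma>1'])
  next
    case False
    then show ?thesis by (intro shift[OF assms(2-4), symmetric]) simp
  qed
  then show ?thesis
    by (simp only: G eq[OF \<sigma>1'(1)])
qed

subsection \<open>Positivity of inverse Mellin transforms\<close>

text \<open>The characteristic function of the normal law, rescaled by \<open>s = t / a\<close>.
  What matters below is the sign: the transform of a Gaussian is positive.\<close>

lemma integral_iexp_gaussian:
  fixes a y :: real
  assumes "a > 0"
  shows "(\<integral>t. iexp (t * y) * of_real (exp (- ((t / a)\<^sup>2 / 2))) \<partial>lborel) =
    of_real (a * sqrt (2 * pi) * exp (- ((a * y)\<^sup>2 / 2)))"
proof -
  let ?N = "\<lambda>s::real. iexp (a * y * s) * of_real (exp (- (s\<^sup>2 / 2)))"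
  have "of_real (exp (- ((a * y)\<^sup>2 / 2))) = char std_normal_distribution (a * y)"
    by (simp add: char_std_normal_distribution)
  also have "\<dots> = (\<integral>s. std_normal_density s *\<^sub>R iexp (a * y * s) \<partial>lborel)"
    unfolding char_def by (intro integral_density) auto
  also have "\<dots> = (\<integral>s. of_real (1 / sqrt (2 * pi)) * ?N s \<partial>lborel)"
    by (intro Bochner_Integration.integral_cong) (auto simp: std_normal_density_def scaleR_conv_of_real mult_ac)
  also have "\<dots> = of_real (1 / sqrt (2 * pi)) * (\<integral>s. ?N s \<partial>lborel)"
    by (rule integral_mult_right_zero)
  finally have N: "(\<integral>s. ?N s \<partial>lborel) = of_real (sqrt (2 * pi) * exp (- ((a * y)\<^sup>2 / 2)))"
    by (simp add: field_simps)
  have "(\<integral>t. iexp (t * y) * of_real (exp (- ((t / a)\<^sup>2 / 2))) \<partial>lborel) =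
      \<bar>a\<bar> *\<^sub>R (\<integral>s. iexp ((0 + a * s) * y) * of_real (exp (- (((0 + a * s) / a)\<^sup>2 / 2))) \<partial>lborel)"
    by (rule lborel_integral_real_affine) (use assms in auto)
  also have "(\<lambda>s. iexp ((0 + a * s) * y) * of_real (exp (- (((0 + a * s) / a)\<^sup>2 / 2)))) = ?N"
    using assms by (auto simp: fun_eq_iff mult_ac)
  finally show ?thesis
    unfolding N using assms by (simp add: scaleR_conv_of_real)
qed

lemma integrable_gaussian_scaled:
  fixes a :: real
  assumes "a > 0"
  shows "integrable lborel (\<lambda>t. exp (- ((t / a)\<^sup>2 / 2)))"
proof -
  have "integrable lborel (\<lambda>s. sqrt (2 * pi) * std_normal_density s)"
    by (intro integrable_mult_right integrable_normal_density) auto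
  then have "integrable lborel (\<lambda>s::real. exp (- (s\<^sup>2 / 2)))"
    by (simp add: std_normal_density_def)
  from lborel_integrable_real_affine[OF this, of "1 / a" 0] assms show ?thesis
    by simp
qed

text \<open>
  Multiplying by \<open>exp (- (t / n)\<^sup>2 / 2)\<close> makes Fubini applicable; the regularised integral is an
  average of Gaussians, hence nonnegative.
\<close>

lemma (in real_distribution) inverse_fourier_char_nonneg:
  assumes "integrable lborel (char M)"
  shows "(\<integral>t. char M t * iexp (- (t * u)) \<partial>lborel) \<in> \<real>\<^sub>\<ge>\<^sub>0"
proof -
  let ?e = "\<lambda>n t::real. exp (- ((t / real (Suc n))\<^sup>2 / 2))"
  let ?I = "\<lambda>n. \<integral>t. char M t * iexp (- (t * u)) * of_real (?e n t) \<partial>lborel"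
  \<comment> \<open>As the cutoff widens the original integral is recovered, with
    \<open>char M\<close> itself as the dominating function; \<open>Suc n\<close> keeps the width
    away from 0.\<close>
  have lim: "?I \<longlonglongrightarrow> (\<integral>t. char M t * iexp (- (t * u)) \<partial>lborel)"
  proof (rule integral_dominated_convergence[where w = "\<lambda>t. norm (char M t)"])
    show "integrable lborel (\<lambda>t. norm (char M t))" using assms by (rule integrable_norm)
    show "AE t in lborel. (\<lambda>n. char M t * iexp (- (t * u)) * of_real (?e n t)) \<longlonglongrightarrow>
        char M t * iexp (- (t * u))"
    proof (rule AE_I2)
      fix t :: real
      have "(\<lambda>n. t / real (Suc n)) \<longlonglongrightarrow> 0"
        by (rule LIMSEQ_Suc[OF lim_const_over_n])
      then have "(\<lambda>n. char M t * iexp (- (t * u)) * of_real (?e n t)) \<longlonglongrightarrow>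
          char M t * iexp (- (t * u)) * of_real (exp (- (0\<^sup>2 / 2)))"
        by (intro tendsto_mult_left tendsto_of_real tendsto_exp tendsto_minus tendsto_divide
              tendsto_power tendsto_const) auto
      then show "(\<lambda>n. char M t * iexp (- (t * u)) * of_real (?e n t)) \<longlonglongrightarrow>
        char M t * iexp (- (t * u))" by (simp only: exp_zero power_zero_numeral div_0 minus_zero of_real_1 mult_1_right)
    qed
    show "AE t in lborel. norm (char M t * iexp (- (t * u)) * of_real (?e n t)) \<le> norm (char M t)" for n
      by (intro AE_I2) (simp add: norm_mult mult_left_le)
  qed (auto intro!: borel_measurable_times borel_measurable_of_real)
  have "?I n \<in> \<real>\<^sub>\<ge>\<^sub>0" for n
  proof -
    let ?a = "real (Suc n)"
    let ?f = "\<lambda>(x, t). iexp (t * (x - u)) * of_real (?e n t)"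
    interpret P: pair_sigma_finite M lborel
      by (intro pair_sigma_finite.intro sigma_finite_measure_axioms lborel.sigma_finite_measure_axioms)
    have int_e: "integrable lborel (?e n)" by (rule integrable_gaussian_scaled) simp
    have meas: "?f \<in> borel_measurable (M \<Otimes>\<^sub>M lborel)"
      unfolding split_beta by measurable
    have int: "integrable (M \<Otimes>\<^sub>M lborel) ?f"
    proof (rule P.Fubini_integrable[OF meas])
      \<comment> \<open>The norm of the kernel is the cutoff alone, so the inner integral is a
        constant.\<close>
      show "integrable M (\<lambda>x. \<integral>t. norm (?f (x, t)) \<partial>lborel)"
        by (simp add: norm_mult)
      show "AE x in M. integrable lborel (\<lambda>t. ?f (x, t))"
      proof (rule AE_I2)
        fix x
        have "(\<lambda>t. ?f (x, t)) \<in> borel_measurable lborel" by simp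
        then show "integrable lborel (\<lambda>t. ?f (x, t))"
          by (intro Bochner_Integration.integrable_bound[OF int_e]) (auto simp: norm_mult)
      qed
    qed
    have "?I n = (\<integral>t. (\<integral>x. ?f (x, t) \<partial>M) \<partial>lborel)"
    proof (rule Bochner_Integration.integral_cong[OF refl])
      fix t
      have "char M t * iexp (- (t * u)) * of_real (?e n t) =
          (\<integral>x. iexp (t * x) * (iexp (- (t * u)) * of_real (?e n t)) \<partial>M)"
        unfolding char_def by (subst integral_mult_left_zero) (simp add: mult_ac)
      also have "\<dots> = (\<integral>x. ?f (x, t) \<partial>M)"
      proof (intro Bochner_Integration.integral_cong refl)
        fix x
        have "iexp (t * (x - u)) = iexp (t * x) * iexp (- (t * u))"
          by (simp add: exp_add[symmetric] algebra_simps)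
        then show "iexp (t * x) * (iexp (- (t * u)) * of_real (?e n t)) = ?f (x, t)"
          by (simp only: prod.case mult.assoc)
      qed
      finally show "char M t * iexp (- (t * u)) * of_real (?e n t) = (\<integral>x. ?f (x, t) \<partial>M)" .
    qed
    also have "\<dots> = (\<integral>x. (\<integral>t. ?f (x, t) \<partial>lborel) \<partial>M)"
      using P.Fubini_integral[of "\<lambda>x t. ?f (x, t)"] int by simp
    also have "\<dots> = (\<integral>x. of_real (?a * sqrt (2 * pi) * exp (- ((?a * (x - u))\<^sup>2 / 2))) \<partial>M)"
      unfolding prod.case
      by (intro Bochner_Integration.integral_cong integral_iexp_gaussian refl) auto
    also have "\<dots> = of_real (\<integral>x. ?a * sqrt (2 * pi) * exp (- ((?a * (x - u))\<^sup>2 / 2)) \<partial>M)"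
      by (rule integral_complex_of_real)
    also have "\<dots> \<in> \<real>\<^sub>\<ge>\<^sub>0"
      by (subst nonneg_Reals_of_real_iff) (auto intro!: integral_nonneg_AE)
    finally show ?thesis .
  qed
  then show ?thesis
    by (intro closed_sequentially[OF closed_nonneg_Reals_complex _ lim]) auto
qed

text \<open>Characteristic functions multiply under independent sums. This allows each factor of
  \<open>malaga_mellin\<close> on the imaginary axis to be realised by a law of its own.\<close>

lemma real_distribution_convolution:
  assumes "real_distribution M" "real_distribution N"
  shows "real_distribution (M \<star> N)"
    and "char (M \<star> N) t = char M t * char N t"
proof -
  interpret M: real_distribution M by fact
  interpret N: real_distribution N by fact
  interpret P: pair_prob_space M N ..
  show "real_distribution (M \<star> N)"
    unfolding convolution_def by (intro P.real_distribution_distr) (simp add: split_beta)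
  have "integrable (M \<Otimes>\<^sub>M N) (\<lambda>z. iexp (t * (fst z + snd z)))"
    by (rule P.integrable_iexp) auto
  from P.integral_fst'[OF this]
  have "(\<integral>z. iexp (t * (fst z + snd z)) \<partial>(M \<Otimes>\<^sub>M N)) = (\<integral>x. \<integral>y. iexp (t * x) * iexp (t * y) \<partial>N \<partial>M)"
    by (simp add: distrib_left exp_add)
  also have "\<dots> = char M t * char N t"
    by (simp add: char_def)
  finally show "char (M \<star> N) t = char M t * char N t"
    unfolding convolution_def char_def
    by (subst integral_distr) (auto simp: split_beta)
qed

text \<open>\<open>D\<close> is the law of \<open>ln X\<close> for a Gamma-distributed
  \<open>X\<close> of shape \<open>a\<close>: its characteristic function is a moment of
  \<open>X\<close> of imaginary order, which is an Euler integral.\<close>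

lemma char_log_Gamma:
  assumes "a > 0"
  obtains D where "real_distribution D"
    "\<And>t. char D t = Gamma (of_real a + \<i> * of_real t) / of_real (Gamma a)"
proof -
  define h where "h = (\<lambda>x::real. indicator {0<..} x * (x powr (a - 1) * exp (- x)) / Gamma a)"
  have Ga: "Gamma a > 0" using assms by (rule Gamma_real_pos)
  have h_meas [measurable]: "h \<in> borel_measurable borel" unfolding h_def by measurable
  have h_nonneg: "h x \<ge> 0" for x using Ga by (simp add: h_def)
  have h_int: "(\<integral>x. h x *\<^sub>R iexp (t * ln x) \<partial>lborel) = Gamma (of_real a + \<i> * of_real t) / of_real (Gamma a)"
    and h_able: "integrable lborel (\<lambda>x. h x *\<^sub>R iexp (t * ln x))" for t
  proof -
    let ?z = "of_real a + \<i> * of_real t :: complex"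
    let ?k = "\<lambda>x. indicator {0<..} x *\<^sub>R (complex_of_real x powr (?z - 1) * of_real (exp (- x)))"
    have eq: "h x *\<^sub>R iexp (t * ln x) = ?k x / of_real (Gamma a)" for x
    proof (cases "x > 0")
      case True
      have "complex_of_real x powr (?z - 1) = complex_of_real x powr (of_real (a - 1)) * complex_of_real x powr (\<i> * of_real t)"
        by (simp add: powr_add[symmetric] algebra_simps)
      also have "complex_of_real x powr (of_real (a - 1)) = of_real (x powr (a - 1))"
        using True by (intro powr_of_real) auto
      also have "complex_of_real x powr (\<i> * of_real t) = iexp (t * ln x)"
        using True by (simp add: powr_def Ln_of_real mult_ac)
      finally show ?thesis using True by (simp add: h_def scaleR_conv_of_real)
    qed (simp add: h_def)
    have "integrable lborel ?k" "integral\<^sup>L lborel ?k = Gamma ?z"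
      using Gamma_set_integral_complex[of ?z] assms
      unfolding set_integrable_def set_lebesgue_integral_def by auto
    then show "(\<integral>x. h x *\<^sub>R iexp (t * ln x) \<partial>lborel) = Gamma ?z / of_real (Gamma a)"
      "integrable lborel (\<lambda>x. h x *\<^sub>R iexp (t * ln x))"
      unfolding eq by auto
  qed
  \<comment> \<open>At \<open>t = 0\<close> the formula says that \<open>h\<close> has mass
    1.\<close>
  have "(\<integral>x. complex_of_real (h x) \<partial>lborel) = 1"
    using h_int[of 0] Ga by (simp add: scaleR_conv_of_real Gamma_complex_of_real)
  then have "(\<integral>x. h x \<partial>lborel) = 1"
    by (simp only: integral_complex_of_real of_real_eq_1_iff)
  moreover have "integrable lborel h"
    using integrable_norm[OF h_able[of 0]] h_nonneg by simp
  ultimately have "emeasure (density lborel h) (space (density lborel h)) = 1"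
    using h_nonneg by (simp add: emeasure_density nn_integral_eq_integral)
  then interpret H: prob_space "density lborel h" by (rule prob_spaceI)
  show ?thesis
  proof
    show "real_distribution (distr (density lborel h) borel ln)"
      by (rule H.real_distribution_distr) simp
    show "char (distr (density lborel h) borel ln) t = Gamma (of_real a + \<i> * of_real t) / of_real (Gamma a)" for t
      unfolding char_def h_int[symmetric] using h_nonneg
      by (subst integral_distr) (auto intro!: integral_density)
  qed
qed

text \<open>\<open>D\<close> is the law of \<open>- E\<close> for an exponential \<open>E\<close> of
  rate \<open>b\<close>. The reflection gives \<open>\<i> * t\<close> the sign it has in the
  denominator of \<open>malaga_mellin\<close>.\<close>

lemma char_minus_exponential:
  assumes "b > 0"
  obtains D where "real_distribution D" "\<And>t. char D t = of_real b / (of_real b + \<i> * of_real t)"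
proof -
  interpret E: prob_space "density lborel (exponential_density b)"
    using assms by (rule prob_space_exponential_density)
  show ?thesis
  proof
    show "real_distribution (distr (density lborel (exponential_density b)) borel uminus)"
      by (rule E.real_distribution_distr) simp
    fix t :: real
    define c where "c = complex_of_real b + \<i> * of_real t"
    have Re_c: "Re c = b" by (simp add: c_def)
    let ?f = "\<lambda>x. of_real b * exp (- (c * of_real x))"
    have c0: "c \<noteq> 0" using assms Re_c by auto
    have eq: "exponential_density b x *\<^sub>R iexp (t * - x) = indicator {0..} x *\<^sub>R ?f x" for x
      by (auto simp: c_def exponential_density_def scaleR_conv_of_real distrib_right exp_add[symmetric] 
            exp_of_real[symmetric] algebra_simps simp del: exp_of_real)
    have si: "set_integrable lborel {0..} ?f"
      unfolding set_integrable_def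
    proof (rule Bochner_Integration.integrable_bound)
      have "integrable (density lborel (exponential_density b)) (\<lambda>x. 1::real)" by simp
      then show "integrable lborel (exponential_density b)"
        using assms by (subst (asm) integrable_density) (auto simp: exponential_density_nonneg)
      show "AE x in lborel. norm (indicator {0..} x *\<^sub>R ?f x) \<le> norm (exponential_density b x)"
        using assms by (auto simp: Re_c exponential_density_def norm_mult mult_ac)
    qed simp
    then have si': "set_integrable lborel (einterval 0 \<infinity>) ?f"
      by (rule set_integrable_subset) (auto simp: einterval_def)
    have "char (distr (density lborel (exponential_density b)) borel uminus) t =
        (\<integral>x. exponential_density b x *\<^sub>R iexp (t * - x) \<partial>lborel)"
      unfolding char_def using assms
      by (subst integral_distr) (auto intro!: integral_density simp: exponential_density_nonneg)
    also have "\<dots> = (LINT x:{0..}|lborel. ?f x)"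
      unfolding eq set_lebesgue_integral_def ..
    \<comment> \<open>The point 0 is a null set; the fundamental theorem is applied on the open
      half-line.\<close>
    also have "\<dots> = (LBINT x=0..\<infinity>. ?f x)"
      unfolding interval_lebesgue_integral_0_infty set_lebesgue_integral_def
      using AE_lborel_singleton[of "0::real"]
      by (intro integral_cong_AE) (auto elim!: eventually_mono simp: indicator_def)
    also have "\<dots> = 0 - (- of_real b / c)"
    proof (rule interval_integral_FTC_integrable[where F = "\<lambda>x. - of_real b / c * exp (- (c * of_real x))"])
      show "((\<lambda>x. - of_real b / c * exp (- (c * of_real x))) has_vector_derivative ?f x) (at x)" for x
      proof -
        have "((\<lambda>z. - of_real b / c * exp (- (c * z))) has_field_derivative ?f x) (at (of_real x))"
          using c0 by (auto intro!: derivative_eq_intros)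
        from has_vector_derivative_real_field[OF this] show ?thesis .
      qed
      show "isCont ?f x" for x by (intro continuous_intros)
      have "((\<lambda>x. - of_real b / c * exp (- (c * of_real x))) \<longlongrightarrow> - of_real b / c * exp (- (c * of_real 0))) (at_right 0)"
        by (intro tendsto_intros)
      then show "(((\<lambda>x. - of_real b / c * exp (- (c * of_real x))) \<circ> real_of_ereal) \<longlongrightarrow> - of_real b / c) (at_right 0)"
        by (simp add: zero_ereal_def ereal_tendsto_simps)
      have "((\<lambda>x. - of_real b / c * exp (- (c * of_real x))) \<longlongrightarrow> 0) at_top"
      proof (rule tendsto_norm_zero_cancel)
        have "((\<lambda>x. norm (of_real b / c) * exp (- (b * x))) \<longlongrightarrow> 0) at_top"
          using assms by real_asymp
        then show "((\<lambda>x. norm (- of_real b / c * exp (- (c * of_real x)))) \<longlongrightarrow> 0) at_top"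
          by (simp add: Re_c norm_mult norm_divide)
      qed
      then show "(((\<lambda>x. - of_real b / c * exp (- (c * of_real x))) \<circ> real_of_ereal) \<longlongrightarrow> 0) (at_left \<infinity>)"
        by (simp add: ereal_tendsto_simps)
    qed (use si' in auto)
    finally show "char (distr (density lborel (exponential_density b)) borel uminus) t =
        of_real b / (of_real b + \<i> * of_real t)" by (simp add: c_def)
  qed
qed

text \<open>On the imaginary axis, which separates because all parameters are positive,
  \<open>malaga_mellin\<close> is a constant times the characteristic function of a sum of two
  log-Gamma variables and a reflected exponential one, all independent. The G-function is then a
  Fourier inversion integral at \<open>ln z\<close>.\<close>

lemma meijer_G_3_0_nonneg:
  assumes "z > 0" "w > 0" "\<alpha> > 0" "\<nu> > 0"
  shows "meijer_G 3 0 [of_real (w + 1)] [of_real w, of_real \<alpha>, of_real \<nu>] (of_real z) \<in> \<real>\<^sub>\<ge>\<^sub>0"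
proof -
  obtain D1 where D1: "real_distribution D1"
    "\<And>t. char D1 t = Gamma (of_real \<alpha> + \<i> * of_real t) / of_real (Gamma \<alpha>)"
    using char_log_Gamma[OF assms(3)] by blast
  obtain D2 where D2: "real_distribution D2"
    "\<And>t. char D2 t = Gamma (of_real \<nu> + \<i> * of_real t) / of_real (Gamma \<nu>)"
    using char_log_Gamma[OF assms(4)] by blast
  obtain D3 where D3: "real_distribution D3" "\<And>t. char D3 t = of_real w / (of_real w + \<i> * of_real t)"
    using char_minus_exponential[OF assms(2)] by blast
  define D where "D = (D1 \<star> (D2 \<star> D3))"
  \<comment> \<open>Characteristic functions are 1 at 0, so the constant must be the value of
    \<open>malaga_mellin\<close> at 0.\<close>
  define C where "C = Gamma \<alpha> * Gamma \<nu> / w"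
  have C: "C > 0" using assms by (simp add: C_def Gamma_real_pos)
  interpret D: real_distribution D
    unfolding D_def by (intro real_distribution_convolution D1 D2 D3)
  have mellin: "malaga_mellin w \<alpha> \<nu> (Complex 0 t) = of_real C * char D t" for t
  proof -
    have "char D t = char D1 t * (char D2 t * char D3 t)"
      unfolding D_def by (simp add: real_distribution_convolution D1(1) D2(1) D3(1))
    then show ?thesis
      using assms Gamma_real_pos[OF assms(3)] Gamma_real_pos[OF assms(4)]
      by (simp add: D1 D2 D3 C_def malaga_mellin_def Complex_eq less_imp_neq[symmetric])
  qed
  have char_eq: "(\<lambda>t. of_real (1 / C) * (of_real C * char D t)) = char D"
    using C by (auto simp: fun_eq_iff)
  have "integrable lborel (\<lambda>t. of_real C * char D t)"
    using integrable_malaga_mellin_line[of w 0 \<alpha> \<nu>] assms unfolding mellin by simp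
  from integrable_mult_right[OF this, of "of_real (1 / C)"]
  have int: "integrable lborel (char D)" unfolding char_eq by simp
  have "meijer_G 3 0 [of_real (w + 1)] [of_real w, of_real \<alpha>, of_real \<nu>] (of_real z) =
    1 / (2 * of_real pi) *
    (\<integral>t. malaga_mellin w \<alpha> \<nu> (Complex 0 t) * of_real z powr (- Complex 0 t) \<partial>lborel)"
    using assms by (intro meijer_G_3_0_eq) auto
  also have "\<dots> = 1 / (2 * of_real pi) * (\<integral>t. of_real C * (char D t * iexp (- (t * ln z))) \<partial>lborel)"
  proof -
    have "of_real z powr (- Complex 0 t) = iexp (- (t * ln z))" for t
      using assms(1) by (simp add: powr_def Ln_of_real Complex_eq mult_ac)
    then show ?thesis by (simp only: mellin mult.assoc)
  qed
  also have "\<dots> = of_real (C / (2 * pi)) * (\<integral>t. char D t * iexp (- (t * ln z)) \<partial>lborel)"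
    by simp
  also have "\<dots> \<in> \<real>\<^sub>\<ge>\<^sub>0"
    using C by (intro nonneg_Reals_mult_I D.inverse_fourier_char_nonneg int) auto
  finally show ?thesis .
qed

subsection \<open>Mellin convolution with an inverse square root\<close>

lemma Gamma_set_integral_scaled_real:
  fixes a v :: real
  assumes "a > 0" "v > 0"
  shows "set_integrable lborel {0<..} (\<lambda>t. t powr (a - 1) * exp (- (v * t)))"
    and "(LINT t:{0<..}|lborel. t powr (a - 1) * exp (- (v * t))) = Gamma a * v powr (- a)"
proof -
  let ?f = "\<lambda>t. indicator {0<..} t *\<^sub>R (t powr (a - 1) * exp (- (v * t)))"
  let ?g = "\<lambda>t. indicator {0<..} t *\<^sub>R (complex_of_real t powr (of_real a - 1) * of_real (exp (- (v * t))))"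
  have eq: "?g t = of_real (?f t)" for t
    using powr_of_real[of t "a - 1"] by (simp add: indicator_def)
  have g: "integrable lborel ?g" "integral\<^sup>L lborel ?g = Gamma (of_real a) * of_real v powr (- of_real a)"
    using Gamma_set_integral_scaled[of "of_real a" v] assms
    unfolding set_integrable_def set_lebesgue_integral_def by simp_all
  show "set_integrable lborel {0<..} (\<lambda>t. t powr (a - 1) * exp (- (v * t)))"
    using integrable_Re[OF g(1)] unfolding set_integrable_def eq by simp
  have "complex_of_real v powr (- of_real a) = of_real (v powr (- a))"
    using powr_of_real[of v "- a"] assms by simp
  then have "complex_of_real (integral\<^sup>L lborel ?f) = of_real (Gamma a * v powr (- a))"
    using g(2) unfolding eq integral_complex_of_real by (simp add: Gamma_complex_of_real)
  then show "(LINT t:{0<..}|lborel. t powr (a - 1) * exp (- (v * t))) = Gamma a * v powr (- a)"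
    unfolding set_lebesgue_integral_def of_real_eq_iff .
qed

lemma powr_minus_Complex:
  assumes "x > 0"
  shows "complex_of_real x powr (- Complex \<sigma> t) = of_real (x powr (- \<sigma>)) * iexp (- (t * ln x))"
  using assms
  by (simp add: powr_def Ln_of_real Complex_eq exp_of_real[symmetric] exp_add[symmetric] algebra_simps
           del: exp_of_real)

text \<open>
  Since \<open>sqrt pi * (x + q) powr (-1/2)\<close> is the Laplace transform of \<open>v powr (-1/2)\<close> at \<open>x + q\<close>, the
  Beta-type integral splits into two Gamma integrals.
\<close>

lemma mellin_inverse_sqrt:
  fixes u :: complex and q :: real
  assumes u: "0 < Re u" "Re u < 1 / 2" and q: "q > 0"
  shows "set_integrable lborel {0<..} (\<lambda>x. of_real x powr (- u - 1) * of_real ((1 + q / x) powr (- (1 / 2))))"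
    and "of_real (sqrt pi) *
           (LINT x:{0<..}|lborel. of_real x powr (- u - 1) * of_real ((1 + q / x) powr (- (1 / 2)))) =
         Gamma u * Gamma (1 / 2 - u) * of_real q powr (- u)"
proof -
  \<comment> \<open>\<open>v\<close> is the Laplace variable. Since
    \<open>(1 + q / x) powr (- (1 / 2))\<close> is \<open>x powr (1 / 2)\<close> times
    \<open>(x + q) powr (- (1 / 2))\<close>, the exponent of \<open>x\<close> becomes
    \<open>1 / 2 - u - 1\<close>.\<close>
  define k :: "real \<times> real \<Rightarrow> complex" where
    "k = (\<lambda>(v, x). indicator {0<..} v *\<^sub>R indicator {0<..} x *\<^sub>R
       (of_real (v powr (- (1 / 2)) * exp (- (v * (x + q)))) * of_real x powr (1 / 2 - u - 1)))"
  have meas: "k \<in> borel_measurable (lborel \<Otimes>\<^sub>M lborel)"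
    unfolding k_def powr_def split_beta by measurable
  have exp_split: "exp (- (v * (x + q))) = exp (- (q * v)) * exp (- (v * x))" for v x
    by (simp add: exp_add[symmetric] algebra_simps)
  \<comment> \<open>The inner integral over \<open>x\<close> converges because
    \<open>Re u < 1 / 2\<close>, the outer one over \<open>v\<close> because
    \<open>0 < Re u\<close>.\<close>
  have inner_x_int: "integrable lborel (\<lambda>x. k (v, x))"
    and inner_x: "(\<integral>x. k (v, x) \<partial>lborel) =
      indicator {0<..} v *\<^sub>R (Gamma (1 / 2 - u) * (of_real v powr (u - 1) * of_real (exp (- (q * v)))))" for v
  proof -
    let ?c = "indicator {0<..} v *\<^sub>R complex_of_real (v powr (- (1 / 2)) * exp (- (q * v)))"
    let ?h = "\<lambda>x. indicator {0<..} x *\<^sub>R (complex_of_real x powr (1 / 2 - u - 1) * of_real (exp (- (v * x))))"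
    have eq: "k (v, x) = ?c * ?h x" for x
      by (simp add: k_def exp_split indicator_def mult_ac)
    have v: "integrable lborel ?h" "integral\<^sup>L lborel ?h = Gamma (1 / 2 - u) * of_real v powr (- (1 / 2 - u))"
      if "v > 0"
      using Gamma_set_integral_scaled[of "1 / 2 - u" v] u that
      unfolding set_integrable_def set_lebesgue_integral_def by auto
    show "integrable lborel (\<lambda>x. k (v, x))"
    proof (cases "v > 0")
      case True
      show ?thesis unfolding eq by (rule integrable_mult_right[OF v(1)[OF True]])
    qed (simp add: k_def)
    have "complex_of_real (v powr (- (1 / 2))) * of_real v powr (- (1 / 2 - u)) = of_real v powr (u - 1)"
      if "v > 0"
    proof -
      have "complex_of_real (v powr (- (1 / 2))) = of_real v powr (- (1 / 2))"
        using powr_of_real[of v "- (1 / 2)"] that by simp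
      then show ?thesis by (simp add: powr_add[symmetric])
    qed
    moreover have "(\<integral>x. k (v, x) \<partial>lborel) = ?c * integral\<^sup>L lborel ?h"
      unfolding eq by (rule integral_mult_right_zero)
    ultimately show "(\<integral>x. k (v, x) \<partial>lborel) =
      indicator {0<..} v *\<^sub>R (Gamma (1 / 2 - u) * (of_real v powr (u - 1) * of_real (exp (- (q * v)))))"
      using v(2) by (cases "v > 0") (simp_all add: mult_ac)
  qed
  have inner_v: "(\<integral>v. k (v, x) \<partial>lborel) =
      of_real (sqrt pi) * (indicator {0<..} x *\<^sub>R
        (of_real x powr (- u - 1) * of_real ((1 + q / x) powr (- (1 / 2)))))" for x
  proof (cases "x > 0")
    case True
    have eq: "k (v, x) = of_real x powr (1 / 2 - u - 1) *
        of_real (indicator {0<..} v *\<^sub>R (v powr (1 / 2 - 1) * exp (- ((x + q) * v))))" for v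
      using True by (simp add: k_def indicator_def mult_ac)
    have "(\<integral>v. k (v, x) \<partial>lborel) = of_real x powr (1 / 2 - u - 1) * of_real (Gamma (1 / 2) * (x + q) powr (- (1 / 2)))"
      unfolding eq integral_mult_right_zero integral_complex_of_real
      using Gamma_set_integral_scaled_real(2)[of "1 / 2" "x + q"] True q
      by (simp add: set_lebesgue_integral_def)
    also have "(x + q) powr (- (1 / 2)) = x powr (- (1 / 2)) * (1 + q / x) powr (- (1 / 2))"
    proof -
      have "x + q = x * (1 + q / x)" using True by (simp add: field_simps)
      then show ?thesis by (simp only: powr_mult)
    qed
    also have "of_real x powr (1 / 2 - u - 1) * of_real (Gamma (1 / 2) * \<dots>) =
       of_real (sqrt pi) * (of_real x powr (1 / 2 - u - 1) * of_real (x powr (- (1 / 2))) * of_real ((1 + q / x) powr (- (1 / 2))))"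
      by (simp add: Gamma_one_half_real mult_ac)
    also have "complex_of_real (x powr (- (1 / 2))) = of_real x powr (- (1 / 2))"
      using powr_of_real[of x "- (1 / 2)"] True by simp
    also have "of_real x powr (1 / 2 - u - 1) * complex_of_real x powr (- (1 / 2)) = of_real x powr (- u - 1)"
      by (simp add: powr_add[symmetric] algebra_simps)
    finally show ?thesis using True by simp
  qed (simp add: k_def)
  \<comment> \<open>The moduli form the same double integral with \<open>Re u\<close> in place of
    \<open>u\<close>, so its finiteness is checked by the same computation.\<close>
  have norm_k: "norm (k (v, x)) = indicator {0<..} v * (v powr (- (1 / 2)) * exp (- (q * v))) *
      (indicator {0<..} x *\<^sub>R (x powr (1 / 2 - Re u - 1) * exp (- (v * x))))" for v x
    by (simp add: k_def exp_split indicator_def norm_mult norm_powr_real_powr mult_ac)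
  have "(\<integral>x. norm (k (v, x)) \<partial>lborel) =
      Gamma (1 / 2 - Re u) * (indicator {0<..} v *\<^sub>R (v powr (Re u - 1) * exp (- (q * v))))" for v
  proof (cases "v > 0")
    case True
    have "(\<integral>x. norm (k (v, x)) \<partial>lborel) =
        v powr (- (1 / 2)) * exp (- (q * v)) * (Gamma (1 / 2 - Re u) * v powr (- (1 / 2 - Re u)))"
      unfolding norm_k integral_mult_right_zero
      using Gamma_set_integral_scaled_real(2)[of "1 / 2 - Re u" v] True u
      by (simp add: set_lebesgue_integral_def)
    also have "\<dots> = Gamma (1 / 2 - Re u) * ((v powr (- (1 / 2)) * v powr (- (1 / 2 - Re u))) * exp (- (q * v)))"
      by (simp add: mult_ac)
    finally show ?thesis using True by (simp add: powr_add[symmetric])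
  qed (simp add: norm_k)
  moreover have "integrable lborel (\<lambda>v. Gamma (1 / 2 - Re u) * (indicator {0<..} v *\<^sub>R (v powr (Re u - 1) * exp (- (q * v)))))"
    using Gamma_set_integral_scaled_real(1)[OF u(1) q]
    unfolding set_integrable_def by (rule integrable_mult_right)
  ultimately have int: "integrable (lborel \<Otimes>\<^sub>M lborel) k"
    using inner_x_int by (intro lborel_pair.Fubini_integrable[OF meas]) auto
  then have int': "integrable (lborel \<Otimes>\<^sub>M lborel) (\<lambda>(v, x). k (v, x))" by simp
  let ?F = "\<lambda>x. indicator {0<..} x *\<^sub>R (complex_of_real x powr (- u - 1) * of_real ((1 + q / x) powr (- (1 / 2))))"
  have "integrable lborel (\<lambda>x. of_real (sqrt pi) * ?F x)"
    using lborel_pair.integrable_snd[OF int'] unfolding inner_v .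
  from integrable_mult_right[OF this, of "of_real (1 / sqrt pi)"]
  have "integrable lborel (\<lambda>x. (of_real (1 / sqrt pi) * of_real (sqrt pi)) * ?F x)"
    unfolding mult.assoc .
  moreover have "complex_of_real (1 / sqrt pi) * of_real (sqrt pi) = 1" by simp
  ultimately show "set_integrable lborel {0<..} (\<lambda>x. of_real x powr (- u - 1) * of_real ((1 + q / x) powr (- (1 / 2))))"
    unfolding set_integrable_def by simp
  have "of_real (sqrt pi) * integral\<^sup>L lborel ?F = (\<integral>x. \<integral>v. k (v, x) \<partial>lborel \<partial>lborel)"
    unfolding inner_v by (rule integral_mult_right_zero[symmetric])
  also have "\<dots> = (\<integral>v. \<integral>x. k (v, x) \<partial>lborel \<partial>lborel)"
    by (rule lborel_pair.Fubini_integral[OF int'])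
  also have "\<dots> = Gamma (1 / 2 - u) *
      (\<integral>v. indicator {0<..} v *\<^sub>R (of_real v powr (u - 1) * of_real (exp (- (q * v)))) \<partial>lborel)"
    unfolding inner_x by (subst integral_mult_right_zero[symmetric]) (simp add: mult_ac)
  also have "\<dots> = Gamma (1 / 2 - u) * (Gamma u * of_real q powr (- u))"
    using Gamma_set_integral_scaled(2)[of u q] u q by (simp add: set_lebesgue_integral_def)
  finally show "of_real (sqrt pi) *
           (LINT x:{0<..}|lborel. of_real x powr (- u - 1) * of_real ((1 + q / x) powr (- (1 / 2)))) =
         Gamma u * Gamma (1 / 2 - u) * of_real q powr (- u)"
    unfolding set_lebesgue_integral_def by (simp add: mult_ac)
qed

text \<open>Fubini, with \<open>mellin_inverse_sqrt\<close> as the inner integral. The modulus of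
  the kernel is the same for all \<open>t\<close>, so integrability of \<open>\<phi>\<close> makes
  the double integral converge, and that of \<open>H\<close> follows without an estimate of the
  Gamma factors. The factor \<open>sqrt pi\<close> is \<open>Gamma (1 / 2)\<close>.\<close>

lemma mellin_convolution_inverse_sqrt:
  fixes \<phi> :: "real \<Rightarrow> complex" and q \<sigma> :: real
  assumes \<phi>: "integrable lborel \<phi>" and \<sigma>: "0 < \<sigma>" "\<sigma> < 1 / 2" and q: "q > 0"
  defines "F \<equiv> \<lambda>x. of_real ((1 + q / x) powr (- (1 / 2)) / x) *
                    (\<integral>t. \<phi> t * of_real x powr (- Complex \<sigma> t) \<partial>lborel)"
    and "H \<equiv> \<lambda>t. \<phi> t * (Gamma (Complex \<sigma> t) * Gamma (1 / 2 - Complex \<sigma> t) * of_real q powr (- Complex \<sigma> t))"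
  shows "set_integrable lborel {0<..} F" and "integrable lborel H"
    and "of_real (sqrt pi) * (LINT x:{0<..}|lborel. F x) = integral\<^sup>L lborel H"
proof -
  define k where "k = (\<lambda>(t, x). \<phi> t * (indicator {0<..} x *\<^sub>R
      (of_real x powr (- Complex \<sigma> t - 1) * of_real ((1 + q / x) powr (- (1 / 2))))))"
  let ?k' = "\<lambda>z. \<phi> (fst z) * (indicator {0<..} (snd z) *\<^sub>R
      (of_real (snd z powr (- \<sigma> - 1)) * iexp (- (fst z * ln (snd z))) * of_real ((1 + q / snd z) powr (- (1 / 2)))))"
  have powr1: "complex_of_real x powr (- Complex \<sigma> t - 1) = of_real (x powr (- \<sigma> - 1)) * iexp (- (t * ln x))"
    if "x > 0" for x t
  proof -
    have "- Complex \<sigma> t - 1 = - Complex (\<sigma> + 1) t" "- \<sigma> - 1 = - (\<sigma> + 1)"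
      by (simp_all add: complex_eq_iff)
    then show ?thesis by (simp only: powr_minus_Complex[OF that])
  qed
  have powr2: "complex_of_real x powr (- Complex \<sigma> t - 1) = of_real x powr (- Complex \<sigma> t) / of_real x"
    if "x > 0" for x t
    using that by (simp add: powr_diff)
  have [measurable]: "\<phi> \<in> borel_measurable borel" using borel_measurable_integrable[OF \<phi>] by simp
  \<comment> \<open>Splitting the complex power into modulus and phase makes joint measurability in
    \<open>(t, x)\<close> evident.\<close>
  have "k = ?k'"
    using powr1 by (auto simp: fun_eq_iff k_def indicator_def)
  moreover have "?k' \<in> borel_measurable (lborel \<Otimes>\<^sub>M lborel)" by measurable
  ultimately have meas: "k \<in> borel_measurable (lborel \<Otimes>\<^sub>M lborel)" by simp
  have mellin: "set_integrable lborel {0<..} (\<lambda>x. of_real x powr (- Complex \<sigma> t - 1) * of_real ((1 + q / x) powr (- (1 / 2))))"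
    "of_real (sqrt pi) *
           (LINT x:{0<..}|lborel. of_real x powr (- Complex \<sigma> t - 1) * of_real ((1 + q / x) powr (- (1 / 2)))) =
         Gamma (Complex \<sigma> t) * Gamma (1 / 2 - Complex \<sigma> t) * of_real q powr (- Complex \<sigma> t)" for t
    using mellin_inverse_sqrt[of "Complex \<sigma> t" q] \<sigma> q by auto
  \<comment> \<open>Only \<open>\<sigma>\<close> enters the modulus of the complex power, so
    \<open>t = 0\<close> stands for every \<open>t\<close>.\<close>
  define c where "c = (\<integral>x. norm (indicator {0<..} x *\<^sub>R
      (complex_of_real x powr (- Complex \<sigma> 0 - 1) * of_real ((1 + q / x) powr (- (1 / 2))))) \<partial>lborel)"
  have "norm (k (t, x)) = norm (\<phi> t) * norm (indicator {0<..} x *\<^sub>R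
      (complex_of_real x powr (- Complex \<sigma> 0 - 1) * of_real ((1 + q / x) powr (- (1 / 2)))))" for t x
    by (auto simp: k_def indicator_def norm_mult norm_powr_real_powr)
  then have norm_k: "(\<integral>x. norm (k (t, x)) \<partial>lborel) = norm (\<phi> t) * c" for t
    unfolding c_def by simp
  have int: "integrable (lborel \<Otimes>\<^sub>M lborel) k"
  proof (rule lborel_pair.Fubini_integrable[OF meas])
    show "integrable lborel (\<lambda>t. \<integral>x. norm (k (t, x)) \<partial>lborel)"
      unfolding norm_k by (intro integrable_mult_left integrable_norm \<phi>)
    show "AE t in lborel. integrable lborel (\<lambda>x. k (t, x))"
      unfolding k_def prod.case using mellin(1)[unfolded set_integrable_def]
      by (intro AE_I2 integrable_mult_right)
  qed
  then have int': "integrable (lborel \<Otimes>\<^sub>M lborel) (\<lambda>(t, x). k (t, x))" by simp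
  have inner_t: "(\<integral>t. k (t, x) \<partial>lborel) = indicator {0<..} x *\<^sub>R F x" for x
  proof (cases "x > 0")
    case True
    have "(\<integral>t. k (t, x) \<partial>lborel) = (\<integral>t. of_real ((1 + q / x) powr (- (1 / 2)) / x) * (\<phi> t * of_real x powr (- Complex \<sigma> t)) \<partial>lborel)"
      using True by (intro Bochner_Integration.integral_cong refl) (simp add: k_def powr2)
    then show ?thesis using True by (simp add: F_def)
  qed (simp add: k_def)
  have inner_x: "of_real (sqrt pi) * (\<integral>x. k (t, x) \<partial>lborel) = H t" for t
    unfolding k_def prod.case H_def mellin(2)[symmetric] set_lebesgue_integral_def
    by (subst integral_mult_right_zero) (simp only: mult_ac)
  show "set_integrable lborel {0<..} F"
    using lborel_pair.integrable_snd[OF int'] unfolding inner_t set_integrable_def .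
  have "integrable lborel (\<lambda>t. of_real (sqrt pi) * (\<integral>x. k (t, x) \<partial>lborel))"
    by (intro integrable_mult_right lborel_pair.integrable_fst[OF int'])
  then show "integrable lborel H" unfolding inner_x .
  have "(LINT x:{0<..}|lborel. F x) = (\<integral>t. \<integral>x. k (t, x) \<partial>lborel \<partial>lborel)"
    unfolding set_lebesgue_integral_def inner_t[symmetric] by (rule lborel_pair.Fubini_integral[OF int'])
  then show "of_real (sqrt pi) * (LINT x:{0<..}|lborel. F x) = integral\<^sup>L lborel H"
    unfolding inner_x[symmetric] by simp
qed

subsection \<open>The G-function with \<open>\<Delta>\<close> parameters\<close>

text \<open>Legendre's formula at \<open>a / 2 + s\<close>; the left side is the product over the
  block \<open>Delta 2 a\<close>. The power of 2 is split into a constant and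
  \<open>4 powr (- s)\<close>, which later merges with the argument of the G-function.\<close>

lemma Gamma_duplication_half_shift:
  fixes s :: complex and a :: real
  assumes "a > 0" "Re s > 0"
  shows "Gamma (of_real a / 2 + s) * Gamma ((of_real a + 1) / 2 + s) =
    of_real (2 powr (1 - a) * sqrt pi) * 4 powr (- s) * Gamma (of_real a + 2 * s)"
proof -
  let ?z = "of_real a / 2 + s"
  have "Re ?z > 0" "Re (?z + 1 / 2) > 0" using assms by auto
  then have nz: "?z \<notin> \<int>\<^sub>\<le>\<^sub>0" "?z + 1 / 2 \<notin> \<int>\<^sub>\<le>\<^sub>0"
    using nonpos_Ints_Re_le_0 by (meson not_le)+
  have z2: "?z + 1 / 2 = (of_real a + 1) / 2 + s" "2 * ?z = of_real a + 2 * s"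
    by (simp_all add: field_simps)
  have ln4: "ln (4::real) = 2 * ln 2"
    using ln_realpow[of 2 2] by simp
  have "exp ((1 - 2 * ?z) * of_real (ln 2)) = exp (of_real ((1 - a) * ln 2)) * exp (- s * of_real (ln 4))"
    unfolding exp_add[symmetric] ln4 by (rule arg_cong[of _ _ exp]) (simp add: algebra_simps)
  also have "exp (of_real ((1 - a) * ln 2)) = complex_of_real (2 powr (1 - a))"
    by (simp only: exp_of_real powr_def) simp
  also have "exp (- s * of_real (ln 4)) = 4 powr (- s)"
    using Ln_of_real[of 4] by (simp add: powr_def)
  finally have "exp ((1 - 2 * ?z) * of_real (ln 2)) = of_real (2 powr (1 - a)) * 4 powr (- s)" .
  then show ?thesis
    using Gamma_legendre_duplication[OF nz] unfolding z2 by (simp add: mult_ac)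
qed

text \<open>Two entries bind: the final 0 of \<open>tau4\<close>, at index \<open>3 * r\<close>
  behind three blocks of length \<open>r\<close>, and the leading \<open>1 / 2\<close> of
  \<open>tau6\<close>. The remaining entries of \<open>tau4\<close> have nonnegative real part. The
  strip is the one on which \<open>mellin_inverse_sqrt\<close> holds.\<close>

lemma separating_line_tau:
  assumes "r \<in> {1, 2}" "\<xi> > 0" "\<alpha> > 0" "n \<ge> 1"
  shows "separating_line (3 * r + 1) 1 (tau6 r \<xi>) (tau4 r \<xi> \<alpha> n) \<sigma> \<longleftrightarrow> 0 < \<sigma> \<and> \<sigma> < 1 / 2"
proof
  assume L: "separating_line (3 * r + 1) 1 (tau6 r \<xi>) (tau4 r \<xi> \<alpha> n) \<sigma>"
  have len: "length (Delta r x) = r" for x by (simp add: Delta_def)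
  have "tau4 r \<xi> \<alpha> n ! (3 * r) = 0"
    by (simp add: tau4_def nth_append len)
  moreover have "Re (- (tau4 r \<xi> \<alpha> n ! (3 * r)) - of_nat 0) < \<sigma>"
    using L unfolding separating_line_def by (metis less_add_one)
  moreover have "\<sigma> < Re (1 - tau6 r \<xi> ! 0 + of_nat 0)"
    using L unfolding separating_line_def by (metis zero_less_one)
  ultimately show "0 < \<sigma> \<and> \<sigma> < 1 / 2"
    by (simp add: tau6_def)
next
  assume R: "0 < \<sigma> \<and> \<sigma> < 1 / 2"
  have len4: "length (tau4 r \<xi> \<alpha> n) = 3 * r + 1"
    by (simp add: tau4_def Delta_def)
  have "\<forall>b \<in> set (tau4 r \<xi> \<alpha> n). 0 \<le> Re b"
    using assms by (auto simp: tau4_def Delta_def)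
  then have nonneg: "0 \<le> Re (tau4 r \<xi> \<alpha> n ! j)" if "j < 3 * r + 1" for j
    using that len4 by (metis nth_mem)
  have "Re (- (tau4 r \<xi> \<alpha> n ! j) - of_nat k) < \<sigma>" if "j < 3 * r + 1" for j k
  proof -
    have "- Re (tau4 r \<xi> \<alpha> n ! j) - real k < \<sigma>"
      using nonneg[OF that] R of_nat_0_le_iff[of k, where 'a = real] by linarith
    then show ?thesis by simp
  qed
  moreover have "\<sigma> < Re (1 - tau6 r \<xi> ! j + of_nat k)" if "j < 1" for j k
    using that R by (simp add: tau6_def)
  ultimately show "separating_line (3 * r + 1) 1 (tau6 r \<xi>) (tau4 r \<xi> \<alpha> n) \<sigma>"
    unfolding separating_line_def by blast
qed

text \<open>
  Gauss' multiplication formula collapses the \<open>\<Delta>\<close> blocks; the \<open>\<xi>\<close> factors reduce to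
  \<open>1 / (\<xi>\<^sup>2 + r s)\<close>.
\<close>

lemma meijer_integrand_tau:
  fixes s :: complex
  assumes "r \<in> {1, 2}" "\<xi> > 0" "\<alpha> > 0" "n \<ge> 1" "Z > 0" "Re s > 0"
  shows "of_real (real r powr (\<alpha> + real n - 1) / (2 * pi) ^ (r - 1)) *
      meijer_integrand (3 * r + 1) 1 (tau6 r \<xi>) (tau4 r \<xi> \<alpha> n) (of_real Z) s =
    of_nat r * malaga_mellin (\<xi>\<^sup>2) \<alpha> (real n) (of_nat r * s) * (Gamma s * Gamma (1 / 2 - s)) *
      of_real (Z * real r ^ (2 * r)) powr (- s)"
proof -
  let ?w = "complex_of_real (\<xi>\<^sup>2)"
  have w: "\<xi>\<^sup>2 > 0" using assms by simp
  from assms(1) consider "r = 1" | "r = 2" by auto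
  then show ?thesis
  proof cases
    case 1
    have nz: "?w + s \<notin> \<int>\<^sub>\<le>\<^sub>0"
      using nonpos_Ints_Re_le_0[of "?w + s"] assms(6) w by auto
    then have quot: "Gamma (?w + s) / Gamma (?w + 1 + s) = 1 / (?w + s)"
      using Gamma_plus1[OF nz] by (simp add: Gamma_eq_zero_iff add_ac)
    have "meijer_integrand 4 1 (tau6 1 \<xi>) (tau4 1 \<xi> \<alpha> n) (of_real Z) s =
        (Gamma (?w + s) / Gamma (?w + 1 + s)) * (Gamma (of_real \<alpha> + s) * Gamma (of_nat n + s)) *
        (Gamma s * Gamma (1 / 2 - s)) * of_real Z powr (- s)"
      by (simp add: meijer_integrand_def tau6_def tau4_def Delta_def eval_nat_numeral mult_ac)
    then show ?thesis
      unfolding quot using 1 by (simp add: malaga_mellin_def mult_ac)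
  next
    case 2
    have dup: "Gamma (of_real a / 2 + s) * Gamma ((of_real a + 1) / 2 + s) =
      of_real (2 powr (1 - a) * sqrt pi) * 4 powr (- s) * Gamma (of_real a + 2 * s)" if "a > 0" for a
      using Gamma_duplication_half_shift[OF that assms(6)] .
    have nz: "?w + 2 * s \<notin> \<int>\<^sub>\<le>\<^sub>0"
      using nonpos_Ints_Re_le_0[of "?w + 2 * s"] assms(6) w by auto
    \<comment> \<open>Duplication at \<open>\<xi>\<^sup>2\<close> and at
      \<open>\<xi>\<^sup>2 + 1\<close>: the powers of 4 cancel, the constants differ by a factor 2,
      and the remaining Gamma values by \<open>\<xi>\<^sup>2 + 2 * s\<close>.\<close>
    have quot: "Gamma (?w / 2 + s) * Gamma ((?w + 1) / 2 + s) /
        (Gamma ((?w + 1) / 2 + s) * Gamma ((?w + 2) / 2 + s)) = 2 / (?w + 2 * s)"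
    proof -
      have "Gamma ((?w + 1) / 2 + s) * Gamma ((?w + 2) / 2 + s) =
         of_real (2 powr (1 - (\<xi>\<^sup>2 + 1)) * sqrt pi) * 4 powr (- s) * Gamma (?w + 2 * s + 1)"
        using dup[of "\<xi>\<^sup>2 + 1"] w by (simp add: add_ac)
      also have "\<dots> = of_real (2 powr (1 - \<xi>\<^sup>2) * sqrt pi) * 4 powr (- s) * Gamma (?w + 2 * s) * ((?w + 2 * s) / 2)"
        using Gamma_plus1[OF nz] by (simp add: powr_diff powr_minus field_simps)
      finally have "Gamma ((?w + 1) / 2 + s) * Gamma ((?w + 2) / 2 + s) =
        Gamma (?w / 2 + s) * Gamma ((?w + 1) / 2 + s) * ((?w + 2 * s) / 2)"
        using dup[OF w] by simp
      moreover have "Gamma (?w / 2 + s) * Gamma ((?w + 1) / 2 + s) \<noteq> 0"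
        unfolding dup[OF w] using nz by (simp add: Gamma_eq_zero_iff)
      moreover have "A / (A * (d / 2)) = 2 / d" if "A \<noteq> 0" for A d :: complex
        using that by simp
      ultimately show ?thesis by presburger
    qed
    have "meijer_integrand 7 1 (tau6 2 \<xi>) (tau4 2 \<xi> \<alpha> n) (of_real Z) s =
        (Gamma (?w / 2 + s) * Gamma ((?w + 1) / 2 + s) /
          (Gamma ((?w + 1) / 2 + s) * Gamma ((?w + 2) / 2 + s))) *
        (Gamma (of_real \<alpha> / 2 + s) * Gamma ((of_real \<alpha> + 1) / 2 + s)) *
        (Gamma (of_real (real n) / 2 + s) * Gamma ((of_real (real n) + 1) / 2 + s)) *
        (Gamma s * Gamma (1 / 2 - s)) * of_real Z powr (- s)"
      by (simp add: meijer_integrand_def tau6_def tau4_def Delta_def eval_nat_numeral mult_ac add_ac)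
    also have "\<dots> = of_real (2 powr (1 - \<alpha>) * 2 powr (1 - real n) * pi) *
       (2 * malaga_mellin (\<xi>\<^sup>2) \<alpha> (real n) (2 * s) * (Gamma s * Gamma (1 / 2 - s)) *
        (4 powr (- s) * 4 powr (- s) * of_real Z powr (- s)))"
    proof -
      have regroup: "2 / d * (of_real (x * h) * p * G1) * (of_real (y * h) * p * G2) * X * z =
          of_real (x * y * (h * h)) * (2 * (G1 * G2 / d) * X * (p * p * z))"
        for d p G1 G2 X z :: complex and x y h :: real
        by (simp add: mult_ac)
      have n: "real n > 0" using assms by simp
      show ?thesis
        unfolding quot dup[OF assms(3)] dup[OF n] regroup malaga_mellin_def by simp
    qed
    \<comment> \<open>The \<open>\<alpha>\<close> block and the \<open>n\<close> block leave one
      \<open>4 powr (- s)\<close> each, hence 16, which is \<open>r ^ (2 * r)\<close> for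
      \<open>r = 2\<close>.\<close>
    also have "4 powr (- s) * 4 powr (- s) * of_real Z powr (- s) = of_real (Z * 16) powr (- s)"
    proof -
      have "complex_of_real (Z * 16) powr (- s) = of_real 16 powr (- s) * of_real Z powr (- s)"
        using assms(5) powr_times_real[of "of_real 16" "of_real Z" "- s"] by (simp add: mult_ac)
      also have "complex_of_real 16 powr (- s) = of_real 4 powr (- s) * of_real 4 powr (- s)"
        using powr_times_real[of "of_real 4" "of_real 4" "- s"] by simp
      finally show ?thesis by simp
    qed
    finally have I: "meijer_integrand 7 1 (tau6 2 \<xi>) (tau4 2 \<xi> \<alpha> n) (of_real Z) s =
        of_real (2 powr (1 - \<alpha>) * 2 powr (1 - real n) * pi) *
        (2 * malaga_mellin (\<xi>\<^sup>2) \<alpha> (real n) (2 * s) * (Gamma s * Gamma (1 / 2 - s)) *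
          of_real (Z * 16) powr (- s))" .
    \<comment> \<open>The origin of the prefactor of the statement: it inverts the constants of the
      two duplications, whose factors \<open>sqrt pi\<close> multiply to \<open>pi\<close>.\<close>
    have "2 powr (\<alpha> + real n - 1) / (2 * pi) * (2 powr (1 - \<alpha>) * 2 powr (1 - real n) * pi) = (1::real)"
      by (simp add: powr_add powr_diff)
    then have K: "complex_of_real (2 powr (\<alpha> + real n - 1) / (2 * pi)) *
        of_real (2 powr (1 - \<alpha>) * 2 powr (1 - real n) * pi) = 1"
      unfolding of_real_mult[symmetric] by simp
    have "complex_of_real (2 powr (\<alpha> + real n - 1) / (2 * pi)) *
        meijer_integrand 7 1 (tau6 2 \<xi>) (tau4 2 \<xi> \<alpha> n) (of_real Z) s =
        2 * malaga_mellin (\<xi>\<^sup>2) \<alpha> (real n) (2 * s) * (Gamma s * Gamma (1 / 2 - s)) *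
          of_real (Z * 16) powr (- s)"
      unfolding I mult.assoc[symmetric] K by (simp only: mult_1_left)
    then show ?thesis
      using 2 by simp
  qed
qed

lemma of_real_powr_of_nat_mult:
  assumes "z > 0"
  shows "complex_of_real z powr (of_nat r * s) = of_real (z ^ r) powr s"
  using assms by (simp add: powr_def Ln_of_real ln_realpow mult_ac flip: of_real_power)

text \<open>The target line is known only to satisfy \<open>0 < \<sigma>\<close> and
  \<open>\<sigma> < 1 / 2\<close>, so the other contour is put at real part
  \<open>r * \<sigma>\<close>. Substituting \<open>s = r * u\<close> turns the power of
  \<open>B * (x / \<mu>) powr (1 / r)\<close> into a power of \<open>B ^ r * x / \<mu>\<close>,
  linear in \<open>x\<close>, with Jacobian \<open>r\<close>.\<close>

lemma meijer_G_3_0_mellin_convolution: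
  fixes r n :: nat and \<xi> \<alpha> B \<mu> q :: real
  assumes r: "r \<in> {1, 2}" and \<xi>: "\<xi> > 0" and \<alpha>: "\<alpha> > 0" and n: "n \<ge> 1"
    and B: "B > 0" and \<mu>: "\<mu> > 0" and q: "q > 0"
  defines "F \<equiv> \<lambda>x. of_real ((1 + q / x) powr (- (1 / 2)) / x) *
      meijer_G 3 0 [of_real (\<xi>\<^sup>2 + 1)] [of_real (\<xi>\<^sup>2), of_real \<alpha>, of_nat n]
        (of_real (B * (x / \<mu>) powr (1 / real r)))"
  shows "set_integrable lborel {0<..} F"
    and "of_real (sqrt pi) * (LINT x:{0<..}|lborel. F x) =
      of_real (real r powr (\<alpha> + real n - 1) / (2 * pi) ^ (r - 1)) *
      meijer_G (3 * r + 1) 1 (tau6 r \<xi>) (tau4 r \<xi> \<alpha> n) (of_real (q * (B / (real r)\<^sup>2) ^ r / \<mu>))"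
proof -
  define Z where "Z = q * (B / (real r)\<^sup>2) ^ r / \<mu>"
  define \<kappa> where "\<kappa> = real r powr (\<alpha> + real n - 1) / (2 * pi) ^ (r - 1)"
  define b where "b = B ^ r / \<mu>"
  let ?I = "meijer_integrand (3 * r + 1) 1 (tau6 r \<xi>) (tau4 r \<xi> \<alpha> n) (of_real Z)"
  let ?\<Phi> = "malaga_mellin (\<xi>\<^sup>2) \<alpha> (real n)"
  define \<phi> where "\<phi> = (\<lambda>\<sigma> t. ?\<Phi> (of_nat r * Complex \<sigma> t) * of_real b powr (- Complex \<sigma> t))"
  define H where "H = (\<lambda>\<sigma> t. \<phi> \<sigma> t *
    (Gamma (Complex \<sigma> t) * Gamma (1 / 2 - Complex \<sigma> t) * of_real q powr (- Complex \<sigma> t)))"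
  have r0: "r > 0" and b: "b > 0" and \<kappa>: "\<kappa> > 0" and Z: "Z > 0"
    using r B \<mu> q by (auto simp: b_def \<kappa>_def Z_def)
  have scale: "of_nat r * Complex \<sigma> t = Complex (real r * \<sigma>) (0 + real r * t)" for \<sigma> t
    by (simp add: complex_eq_iff)
  \<comment> \<open>The reason for the \<open>r\<^sup>2\<close> in
    \<open>(B / r\<^sup>2) ^ r\<close>: it cancels the power of \<open>r\<close> left by the
    multiplication formula.\<close>
  have Zb: "Z * real r ^ (2 * r) = b * q"
    using r0 by (simp add: Z_def b_def power_divide power_mult[symmetric])
  have ok: "- \<xi>\<^sup>2 < real r * \<sigma>" "- \<alpha> < real r * \<sigma>" "- real n < real r * \<sigma>" if "\<sigma> > 0" for \<sigma>
    using mult_pos_pos[of "real r" \<sigma>] that r0 \<xi> \<alpha> n by (auto intro: le_less_trans[of _ 0])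
  have I: "?I (Complex \<sigma> t) = of_real (real r / \<kappa>) * H \<sigma> t" if "0 < \<sigma>" "\<sigma> < 1 / 2" for \<sigma> t
  proof -
    have "complex_of_real (b * q) powr (- Complex \<sigma> t) = of_real b powr (- Complex \<sigma> t) * of_real q powr (- Complex \<sigma> t)"
      using powr_times_real[of "of_real b" "of_real q" "- Complex \<sigma> t"] b q by simp
    then have "of_real \<kappa> * ?I (Complex \<sigma> t) = of_real (real r) * H \<sigma> t"
      using meijer_integrand_tau[OF r \<xi> \<alpha> n Z, of "Complex \<sigma> t"] that
      unfolding \<kappa>_def[symmetric] Zb by (simp add: H_def \<phi>_def mult_ac)
    then show ?thesis using \<kappa> by (simp add: field_simps)
  qed
  have cont_H: "continuous_on UNIV (H \<sigma>)" if "0 < \<sigma>" "\<sigma> < 1 / 2" for \<sigma>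
  proof -
    have contG: "continuous_on {z. 0 < Re z} (Gamma :: complex \<Rightarrow> complex)"
      using nonpos_Ints_Re_le_0 by (intro continuous_on_Gamma) force
    have "continuous_on UNIV (\<lambda>t. ?\<Phi> (of_nat r * Complex \<sigma> t))"
      unfolding scale
      by (rule continuous_on_compose2[OF continuous_on_malaga_mellin_line[OF ok[OF that(1)]]])
         (auto intro!: continuous_intros)
    moreover have line: "continuous_on UNIV (\<lambda>t. Complex \<sigma> t)"
      by (auto intro!: continuous_intros simp: Complex_eq)
    moreover have "continuous_on UNIV (\<lambda>t. Gamma (Complex \<sigma> t))"
      by (rule continuous_on_compose2[OF contG line]) (use that in auto)
    moreover have "continuous_on UNIV (\<lambda>t. Gamma (1 / 2 - Complex \<sigma> t))"
      by (rule continuous_on_compose2[OF contG continuous_on_diff[OF continuous_on_const line]]) (use that in auto)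
    ultimately show ?thesis
      unfolding H_def \<phi>_def using b q
      by (intro continuous_intros) auto
  qed
  have \<phi>_int: "integrable lborel (\<phi> \<sigma>)" if "0 < \<sigma>" "\<sigma> < 1 / 2" for \<sigma>
  proof -
    have cont: "continuous_on UNIV (\<lambda>t. ?\<Phi> (of_nat r * Complex \<sigma> t))"
      unfolding scale
      by (rule continuous_on_compose2[OF continuous_on_malaga_mellin_line[OF ok[OF that(1)]]])
         (auto intro!: continuous_intros)
    have cont': "continuous_on UNIV (\<phi> \<sigma>)"
      unfolding \<phi>_def using b cont
      by (intro continuous_intros) (auto intro!: continuous_intros simp: Complex_eq)
    have "integrable lborel (\<lambda>t. ?\<Phi> (of_nat r * Complex \<sigma> t))"
      unfolding scale using r0
      by (intro lborel_integrable_real_affine integrable_malaga_mellin_line ok that) auto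
    from integrable_mult_left[OF integrable_norm[OF this], of "b powr (- \<sigma>)"]
    show ?thesis
    proof (rule Bochner_Integration.integrable_bound)
      show "\<phi> \<sigma> \<in> borel_measurable lborel"
        using borel_measurable_continuous_onI[OF cont'] by simp
    qed (use b in \<open>auto simp: \<phi>_def norm_mult norm_powr_real_powr\<close>)
  qed
  have H_eq: "(\<lambda>t. \<phi> \<sigma> t * (Gamma (Complex \<sigma> t) * Gamma (1 / 2 - Complex \<sigma> t) *
      of_real q powr (- Complex \<sigma> t))) = H \<sigma>" for \<sigma>
    by (simp only: H_def)
  note conv = mellin_convolution_inverse_sqrt[where \<phi> = "\<phi> \<sigma>" and \<sigma> = \<sigma> for \<sigma>,
      OF \<phi>_int _ _ q, unfolded H_eq]
  have sep: "separating_line (3 * r + 1) 1 (tau6 r \<xi>) (tau4 r \<xi> \<alpha> n) (1 / 4)"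
    by (subst separating_line_tau[OF r \<xi> \<alpha> n]) simp
  obtain \<sigma> where \<sigma>': "separating_line (3 * r + 1) 1 (tau6 r \<xi>) (tau4 r \<xi> \<alpha> n) \<sigma>"
    and G: "meijer_G (3 * r + 1) 1 (tau6 r \<xi>) (tau4 r \<xi> \<alpha> n) (of_real Z) =
        1 / (2 * of_real pi) * (\<integral>t. ?I (Complex \<sigma> t) \<partial>lborel)"
  proof (rule meijer_G_eq_line_integral[OF sep])
    fix \<sigma> assume "separating_line (3 * r + 1) 1 (tau6 r \<xi>) (tau4 r \<xi> \<alpha> n) \<sigma>"
    then have \<sigma>: "0 < \<sigma>" "\<sigma> < 1 / 2" unfolding separating_line_tau[OF r \<xi> \<alpha> n] by simp_all
    show "continuous_on UNIV (\<lambda>t. ?I (Complex \<sigma> t))"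
      unfolding I[OF \<sigma>] by (intro continuous_intros cont_H \<sigma>)
    \<comment> \<open>By \<open>I\<close> the target integrand is a multiple of \<open>H\<close>,
      whose integrability came out of Fubini.\<close>
    show "integrable lborel (\<lambda>t. ?I (Complex \<sigma> t))"
      unfolding I[OF \<sigma>] by (intro integrable_mult_right conv(2) \<sigma>)
  qed
  have \<sigma>: "0 < \<sigma>" "\<sigma> < 1 / 2" using \<sigma>'
    unfolding separating_line_tau[OF r \<xi> \<alpha> n] by simp_all
  let ?K = "\<lambda>x. of_real ((1 + q / x) powr (- (1 / 2)) / x) *
                    (\<integral>t. \<phi> \<sigma> t * of_real x powr (- Complex \<sigma> t) \<partial>lborel)"
  have F: "F x = of_real (real r / (2 * pi)) * ?K x" if "x > 0" for x
  proof -
    define z where "z = B * (x / \<mu>) powr (1 / real r)"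
    have z: "z > 0" using B \<mu> that by (simp add: z_def)
    have zr: "z ^ r = b * x"
      using that \<mu> r0 by (simp add: z_def b_def power_mult_distrib powr_realpow[symmetric] powr_powr)
    let ?f = "\<lambda>t. ?\<Phi> (Complex (real r * \<sigma>) t) * of_real z powr (- Complex (real r * \<sigma>) t)"
    have f: "?f (0 + real r * t) = \<phi> \<sigma> t * of_real x powr (- Complex \<sigma> t)" for t
    proof -
      have "complex_of_real (b * x) powr (- Complex \<sigma> t) = of_real b powr (- Complex \<sigma> t) * of_real x powr (- Complex \<sigma> t)"
        using powr_times_real[of "of_real b" "of_real x" "- Complex \<sigma> t"] b that by simp
      moreover have "complex_of_real z powr (- Complex (real r * \<sigma>) (0 + real r * t)) =
          of_real (b * x) powr (- Complex \<sigma> t)"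
        unfolding scale[symmetric] zr[symmetric] of_real_powr_of_nat_mult[OF z, symmetric] by simp
      ultimately show ?thesis by (simp only: \<phi>_def scale mult.assoc)
    qed
    have "meijer_G 3 0 [of_real (\<xi>\<^sup>2 + 1)] [of_real (\<xi>\<^sup>2), of_real \<alpha>, of_nat n] (of_real z) =
        1 / (2 * of_real pi) * integral\<^sup>L lborel ?f"
      using meijer_G_3_0_eq[OF z ok[OF \<sigma>(1)], unfolded of_real_of_nat_eq] .
    also have "integral\<^sup>L lborel ?f = of_nat r * (\<integral>t. ?f (0 + real r * t) \<partial>lborel)"
      using lborel_integral_real_affine[of "real r" ?f 0] r0 by (simp add: scaleR_conv_of_real)
    finally show ?thesis
      unfolding f F_def z_def[symmetric] by (simp add: mult_ac)
  qed
  have "set_integrable lborel {0<..} (\<lambda>x. of_real (real r / (2 * pi)) * ?K x)"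
    by (intro set_integrable_mult_right conv(1) \<sigma>)
  moreover have "set_integrable lborel {0<..} F =
      set_integrable lborel {0<..} (\<lambda>x. of_real (real r / (2 * pi)) * ?K x)"
    using F by (intro set_integrable_cong) auto
  ultimately show "set_integrable lborel {0<..} F" by simp
  have "(LINT x:{0<..}|lborel. F x) = (LINT x:{0<..}|lborel. of_real (real r / (2 * pi)) * ?K x)"
    using F by (intro set_lebesgue_integral_cong) auto
  also have "\<dots> = of_real (real r / (2 * pi)) * (LINT x:{0<..}|lborel. ?K x)"
    by (rule set_integral_mult_right)
  finally have "of_real (sqrt pi) * (LINT x:{0<..}|lborel. F x) =
      of_real (real r / (2 * pi)) * (of_real (sqrt pi) * (LINT x:{0<..}|lborel. ?K x))"
    by (simp only: mult_ac)
  also have "\<dots> = of_real (real r / (2 * pi)) * integral\<^sup>L lborel (H \<sigma>)"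
    by (subst conv(3)) (use \<sigma> in auto)
  also have "\<dots> = of_real \<kappa> * meijer_G (3 * r + 1) 1 (tau6 r \<xi>) (tau4 r \<xi> \<alpha> n) (of_real Z)"
    unfolding G I[OF \<sigma>] using \<kappa> by (subst integral_mult_right_zero) (simp add: field_simps)
  finally show "of_real (sqrt pi) * (LINT x:{0<..}|lborel. F x) =
      of_real (real r powr (\<alpha> + real n - 1) / (2 * pi) ^ (r - 1)) *
      meijer_G (3 * r + 1) 1 (tau6 r \<xi>) (tau4 r \<xi> \<alpha> n) (of_real (q * (B / (real r)\<^sup>2) ^ r / \<mu>))"
    unfolding \<kappa>_def Z_def .
qed

subsection \<open>The Gaussian Q-function and the RF hop\<close>

text \<open>A partial fraction expansion. Pascal's rule makes the sum for \<open>Suc j\<close> the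
  difference of the sums for \<open>j\<close> at \<open>N\<close> and at \<open>N + 1\<close>, and
  the closed form obeys the same recursion.\<close>

lemma sum_alternating_binomial_divide:
  fixes N :: real
  assumes "N > 0"
  shows "(\<Sum>k\<le>j. (-1) ^ k * real (j choose k) / (N + real k)) = fact j / pochhammer N (Suc j)"
  using assms
proof (induction j arbitrary: N)
  case (Suc j)
  let ?S = "\<lambda>N. \<Sum>k\<le>j. (-1) ^ k * real (j choose k) / (N + real k)"
  let ?f = "\<lambda>k. (-1) ^ k * real (j choose k) / (N + real k)"
  have "(\<Sum>k\<le>Suc j. (-1) ^ k * real (Suc j choose k) / (N + real k)) =
      1 / N + (\<Sum>k\<le>j. (-1) ^ Suc k * real (Suc j choose Suc k) / (N + real (Suc k)))"
    by (simp add: sum.atMost_Suc_shift del: sum.atMost_Suc binomial_Suc_Suc)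
  also have "(\<Sum>k\<le>j. (-1) ^ Suc k * real (Suc j choose Suc k) / (N + real (Suc k))) =
      (\<Sum>k\<le>j. ?f (Suc k) - ((-1) ^ k * real (j choose k) / ((N + 1) + real k)))"
    by (intro sum.cong refl) (simp add: add_divide_distrib[symmetric] algebra_simps)
  also have "\<dots> = (\<Sum>k\<le>j. ?f (Suc k)) - ?S (N + 1)"
    by (rule sum_subtractf)
  also have "1 / N + ((\<Sum>k\<le>j. ?f (Suc k)) - ?S (N + 1)) = (\<Sum>k\<le>Suc j. ?f k) - ?S (N + 1)"
    by (simp add: sum.atMost_Suc_shift del: sum.atMost_Suc)
  \<comment> \<open>The top term vanishes because \<open>j choose Suc j\<close> is 0.\<close>
  also have "(\<Sum>k\<le>Suc j. ?f k) = ?S N" by simp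
  also have "?S N - ?S (N + 1) = fact j / pochhammer N (Suc j) - fact j / pochhammer (N + 1) (Suc j)"
    using Suc.prems by (simp only: Suc.IH[OF Suc.prems] Suc.IH[of "N + 1"] add_pos_pos zero_less_one)
  also have "\<dots> = fact (Suc j) / pochhammer N (Suc (Suc j))"
  proof -
    let ?P = "pochhammer (N + 1) j"
    have P: "?P > 0" using Suc.prems by (intro pochhammer_pos) simp
    have "pochhammer N (Suc j) = N * ?P" by (rule pochhammer_rec)
    moreover have "pochhammer (N + 1) (Suc j) = ?P * (N + 1 + real j)" by (rule pochhammer_Suc)
    moreover have "pochhammer N (Suc (Suc j)) = N * (?P * (N + 1 + real j))"
      by (subst pochhammer_rec, subst pochhammer_Suc) simp
    moreover have "d / (N * ?P) - d / (?P * c) = d * (c - N) / (N * (?P * c))" if "c > 0" for c d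
      using P Suc.prems that by (simp add: divide_simps) (simp add: algebra_simps)
    from this[of "N + 1 + real j" "fact j"]
    have "fact j / (N * ?P) - fact j / (?P * (N + 1 + real j)) =
        fact (Suc j) / (N * (?P * (N + 1 + real j)))"
      using Suc.prems by (simp add: mult.commute)
    ultimately show ?thesis by (simp only:)
  qed
  finally show ?case .
qed simp

text \<open>With \<open>N = M - m + 1\<close> and \<open>j = m - 1\<close> the Pochhammer product is
  \<open>fact M / fact (M - m)\<close>, so the sum is the reciprocal of
  \<open>m * (M choose m)\<close>.\<close>

lemma rf_weights_sum:
  assumes "1 \<le> m" "m \<le> M"
  shows "real m * real (M choose m) *
    (\<Sum>k<m. (-1) ^ k * real ((m - 1) choose k) / (real M - real m + real k + 1)) = 1"
proof -
  obtain j where j: "m = Suc j" using assms by (cases m) auto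
  define N where "N = real M - real m + 1"
  have N: "N > 0" "N = 1 + real (M - m)" using assms by (auto simp: N_def of_nat_diff)
  have "fact M = pochhammer 1 (M - m) * pochhammer N (Suc j)"
    using pochhammer_product[of "M - m" M "1::real"] assms unfolding N(2)
    by (simp add: pochhammer_fact j)
  then have poch: "pochhammer N (Suc j) = fact M / fact (M - m)"
    by (simp add: pochhammer_fact[symmetric])
  have "(\<Sum>k<m. (-1) ^ k * real ((m - 1) choose k) / (real M - real m + real k + 1)) =
      (\<Sum>k\<le>j. (-1) ^ k * real (j choose k) / (N + real k))"
    unfolding j lessThan_Suc_atMost by (intro sum.cong refl) (simp add: N_def j algebra_simps)
  also have "\<dots> = fact j / pochhammer N (Suc j)"
    using N(1) by (rule sum_alternating_binomial_divide)
  finally show ?thesis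
    using assms unfolding poch by (simp add: binomial_fact j)
qed

text \<open>As a tail probability \<open>gauss_Q\<close> is visibly bounded and decreasing, and its
  measurability comes from monotonicity.\<close>

lemma gauss_Q_eq_measure: "gauss_Q x = measure std_normal_distribution {x..}"
proof -
  interpret prob_space std_normal_distribution
    using real_dist_normal_dist by (simp add: real_distribution_def)
  have "measure std_normal_distribution {x..} = (\<integral>t. indicator {x..} t \<partial>std_normal_distribution)"
    by simp
  also have "\<dots> = (\<integral>t. std_normal_density t *\<^sub>R indicator {x..} t \<partial>lborel)"
    by (intro integral_density) auto
  also have "\<dots> = (\<integral>t. 1 / sqrt (2 * pi) * (indicator {x..} t *\<^sub>R exp (- t\<^sup>2 / 2)) \<partial>lborel)"
    by (intro Bochner_Integration.integral_cong refl) (simp add: std_normal_density_def)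
  also have "\<dots> = gauss_Q x"
    unfolding gauss_Q_def set_lebesgue_integral_def by (rule integral_mult_right_zero)
  finally show ?thesis by simp
qed

lemma gauss_Q_bounds: "0 \<le> gauss_Q x" "gauss_Q x \<le> 1"
proof -
  interpret prob_space std_normal_distribution
    using real_dist_normal_dist by (simp add: real_distribution_def)
  show "0 \<le> gauss_Q x" "gauss_Q x \<le> 1"
    by (simp_all add: gauss_Q_eq_measure)
qed

lemma borel_measurable_gauss_Q [measurable]: "gauss_Q \<in> borel_measurable borel"
proof -
  interpret prob_space std_normal_distribution
    using real_dist_normal_dist by (simp add: real_distribution_def)
  have "mono (\<lambda>x. - gauss_Q x)"
    unfolding gauss_Q_eq_measure by (intro monoI le_imp_neg_le finite_measure_mono) auto
  then have "(\<lambda>x. - (- gauss_Q x)) \<in> borel_measurable borel"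
    by (intro borel_measurable_uminus borel_measurable_mono)
  then show ?thesis by simp
qed

section \<open>Averaging the Q-function over an exponential law\<close>

lemma half_gaussian_integral:
  fixes p :: real
  assumes "p > 0"
  shows "integrable lborel (\<lambda>t. indicator {0..} t *\<^sub>R exp (- (p * t\<^sup>2)))"
    and "(\<integral>t. indicator {0..} t *\<^sub>R exp (- (p * t\<^sup>2)) \<partial>lborel) = sqrt (pi / p) / 2"
proof -
  let ?f = "\<lambda>x::real. indicator {0..} x *\<^sub>R exp (- x\<^sup>2)"
  have f: "integrable lborel ?f" "integral\<^sup>L lborel ?f = sqrt pi / 2"
    using gaussian_moment_0 by (auto simp: has_bochner_integral_iff)
  have eq: "?f (0 + sqrt p * t) = indicator {0..} t *\<^sub>R exp (- (p * t\<^sup>2))" for t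
    using assms by (simp add: indicator_def zero_le_mult_iff power_mult_distrib)
  show "integrable lborel (\<lambda>t. indicator {0..} t *\<^sub>R exp (- (p * t\<^sup>2)))"
    using lborel_integrable_real_affine[OF f(1), of "sqrt p" 0] assms unfolding eq by simp
  have "sqrt pi / 2 = sqrt p * (\<integral>t. indicator {0..} t *\<^sub>R exp (- (p * t\<^sup>2)) \<partial>lborel)"
    using lborel_integral_real_affine[of "sqrt p" ?f 0] assms unfolding eq f(2) by simp
  then show "(\<integral>t. indicator {0..} t *\<^sub>R exp (- (p * t\<^sup>2)) \<partial>lborel) = sqrt (pi / p) / 2"
    using assms by (simp add: real_sqrt_divide field_simps)
qed

lemma exponential_set_integral:
  fixes l :: real
  assumes "l > 0"
  shows "set_integrable lborel {0..} (\<lambda>x. l * exp (- (l * x)))"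
    and "(LINT x:{0..}|lborel. l * exp (- (l * x))) = 1"
    and "b \<ge> 0 \<Longrightarrow> (LINT x:{0..b}|lborel. l * exp (- (l * x))) = 1 - exp (- (l * b))"
proof -
  have D: "((\<lambda>x. - exp (- (l * x))) has_real_derivative l * exp (- (l * x))) (at x)" for x
    by (auto intro!: derivative_eq_intros)
  have eq: "exponential_density l = (\<lambda>x. indicator {0..} x *\<^sub>R (l * exp (- (l * x))))"
    by (simp add: fun_eq_iff exponential_density_def indicator_def mult_ac)
  have "(\<integral>\<^sup>+x. ennreal (exponential_density l x) \<partial>lborel) = ennreal 1"
    using prob_space.emeasure_space_1[OF prob_space_exponential_density[OF assms]]
    by (simp add: emeasure_density)
  then have "has_bochner_integral lborel (exponential_density l) 1"
    using assms by (intro has_bochner_integral_nn_integral) (auto simp: exponential_density_nonneg)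
  then show "set_integrable lborel {0..} (\<lambda>x. l * exp (- (l * x)))"
    and "(LINT x:{0..}|lborel. l * exp (- (l * x))) = 1"
    unfolding set_integrable_def set_lebesgue_integral_def
    by (simp_all add: has_bochner_integral_iff eq)
  assume "b \<ge> 0"
  then have "(\<integral>x. l * exp (- (l * x)) * indicator {0..b} x \<partial>lborel) = - exp (- (l * b)) - - exp (- (l * 0))"
    by (intro integral_FTC_Icc_real D) (auto intro!: continuous_intros)
  then show "(LINT x:{0..b}|lborel. l * exp (- (l * x))) = 1 - exp (- (l * b))"
    unfolding set_lebesgue_integral_def by (simp add: mult_ac)
qed

text \<open>With \<open>Z\<close> standard normal and \<open>X\<close> exponential of rate
  \<open>l\<close>, independent, this is the probability of \<open>sqrt (a * X) \<le> Z\<close>.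
  Fixing \<open>Z = t \<ge> 0\<close> instead of \<open>X\<close> leaves the event
  \<open>X \<le> t\<^sup>2 / a\<close> of probability
  \<open>1 - exp (- (l * (t\<^sup>2 / a)))\<close>, hence a difference of two half Gaussian
  integrals.\<close>

lemma laplace_gauss_Q_sqrt:
  fixes a l :: real
  assumes a: "a > 0" and l: "l > 0"
  shows "set_integrable lborel {0..} (\<lambda>x. l * exp (- (l * x)) * gauss_Q (sqrt (a * x)))"
    and "(LINT x:{0..}|lborel. l * exp (- (l * x)) * gauss_Q (sqrt (a * x))) = 1 / 2 - sqrt (a / (a + 2 * l)) / 2"
proof -
  let ?g = "\<lambda>x. indicator {0..} x *\<^sub>R (l * exp (- (l * x)))"
  define k where "k = (\<lambda>(x, t). ?g x * (indicator {sqrt (a * x)..} t *\<^sub>R std_normal_density t))"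
  have g: "integrable lborel ?g"
    using exponential_set_integral(1)[OF l] unfolding set_integrable_def .
  have Q: "(\<integral>t. indicator {y..} t *\<^sub>R std_normal_density t \<partial>lborel) = gauss_Q y" for y
    unfolding gauss_Q_def set_lebesgue_integral_def
    by (subst integral_mult_right_zero[symmetric]) (simp add: std_normal_density_def mult_ac)
  have Q_int: "integrable lborel (\<lambda>t. indicator {y..} t *\<^sub>R std_normal_density t)" for y
    using integrable_mult_indicator[of "{y..}" lborel std_normal_density] integrable_normal_density[of 1 0]
    by simp
  have inner_t: "(\<integral>t. k (x, t) \<partial>lborel) = ?g x * gauss_Q (sqrt (a * x))" for x
    unfolding k_def prod.case by (subst integral_mult_right_zero) (simp only: Q)
  have k_nonneg: "k z \<ge> 0" for z
    using l by (auto simp: k_def split_beta)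
  have "k = (\<lambda>z. ?g (fst z) * (if sqrt (a * fst z) \<le> snd z then std_normal_density (snd z) else 0))"
    by (auto simp: k_def fun_eq_iff indicator_def)
  also have "\<dots> \<in> borel_measurable (lborel \<Otimes>\<^sub>M lborel)" by measurable
  finally have meas: "k \<in> borel_measurable (lborel \<Otimes>\<^sub>M lborel)" .
  have gQ: "integrable lborel (\<lambda>x. ?g x * gauss_Q (sqrt (a * x)))"
  proof (rule Bochner_Integration.integrable_bound[OF g])
    show "AE x in lborel. norm (?g x * gauss_Q (sqrt (a * x))) \<le> norm (?g x)"
      using gauss_Q_bounds by (intro AE_I2) (simp add: abs_mult mult_left_le)
  qed simp
  then show "set_integrable lborel {0..} (\<lambda>x. l * exp (- (l * x)) * gauss_Q (sqrt (a * x)))"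
    unfolding set_integrable_def by (simp add: mult_ac)
  have int: "integrable (lborel \<Otimes>\<^sub>M lborel) k"
  proof (rule lborel_pair.Fubini_integrable[OF meas])
    show "integrable lborel (\<lambda>x. \<integral>t. norm (k (x, t)) \<partial>lborel)"
      using gQ k_nonneg by (simp add: inner_t)
    show "AE x in lborel. integrable lborel (\<lambda>t. k (x, t))"
      unfolding k_def prod.case by (intro AE_I2 integrable_mult_right Q_int)
  qed
  then have int': "integrable (lborel \<Otimes>\<^sub>M lborel) (\<lambda>(x, t). k (x, t))" by simp
  have inner_x: "(\<integral>x. k (x, t) \<partial>lborel) =
      1 / sqrt (2 * pi) * (indicator {0..} t *\<^sub>R exp (- (1 / 2 * t\<^sup>2)) -
        indicator {0..} t *\<^sub>R exp (- ((1 / 2 + l / a) * t\<^sup>2)))" for t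
  proof (cases "t \<ge> 0")
    case True
    have "sqrt (a * x) \<le> t \<longleftrightarrow> x \<le> t\<^sup>2 / a" if "x \<ge> 0" for x
    proof -
      have "sqrt (a * x) \<le> t \<longleftrightarrow> a * x \<le> t\<^sup>2"
        using True a that by (metis real_sqrt_le_iff real_sqrt_unique sqrt_le_D real_le_rsqrt real_sqrt_abs abs_of_nonneg)
      then show ?thesis using a by (simp add: field_simps)
    qed
    then have "k (x, t) = std_normal_density t * (indicator {0..t\<^sup>2 / a} x *\<^sub>R (l * exp (- (l * x))))" for x
      by (auto simp: k_def indicator_def)
    then have "(\<integral>x. k (x, t) \<partial>lborel) =
        std_normal_density t * (LINT x:{0..t\<^sup>2 / a}|lborel. l * exp (- (l * x)))"
      unfolding set_lebesgue_integral_def by (simp only: integral_mult_right_zero)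
    also have "\<dots> = std_normal_density t * (1 - exp (- (l * (t\<^sup>2 / a))))"
      using exponential_set_integral(3)[OF l, of "t\<^sup>2 / a"] a by simp
    finally have "(\<integral>x. k (x, t) \<partial>lborel) = \<dots>" .
    moreover have "exp (- (t\<^sup>2 / 2)) * exp (- (l * (t\<^sup>2 / a))) = exp (- ((1 / 2 + l / a) * t\<^sup>2))"
      unfolding exp_add[symmetric] by (simp add: algebra_simps)
    ultimately show ?thesis
      using True by (simp add: std_normal_density_def right_diff_distrib)
  next
    case False
    then have "k (x, t) = 0" for x
      using a by (auto simp: k_def indicator_def intro: order_trans[of 0 "sqrt (a * x)" t])
    then show ?thesis using False by simp
  qed
  have p: "1 / 2 + l / a > 0" using a l by (simp add: add_pos_pos)
  have "(\<integral>x. ?g x * gauss_Q (sqrt (a * x)) \<partial>lborel) = (\<integral>t. \<integral>x. k (x, t) \<partial>lborel \<partial>lborel)"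
    unfolding inner_t[symmetric] by (rule lborel_pair.Fubini_integral[OF int', symmetric])
  also have "\<dots> = 1 / sqrt (2 * pi) * (sqrt (pi / (1 / 2)) / 2 - sqrt (pi / (1 / 2 + l / a)) / 2)"
    unfolding inner_x
    by (subst integral_mult_right_zero, subst Bochner_Integration.integral_diff)
       (use half_gaussian_integral[of "1 / 2"] half_gaussian_integral[OF p] in auto)
  also have "\<dots> = 1 / 2 - sqrt (pi / (1 / 2 + l / a)) / sqrt (2 * pi) / 2"
    by (simp add: field_simps)
  also have "sqrt (pi / (1 / 2 + l / a)) / sqrt (2 * pi) = sqrt (a / (a + 2 * l))"
  proof -
    have "1 / 2 + l / a = (a + 2 * l) / (2 * a)" using a by (simp add: field_simps)
    moreover have "pi / (d / (2 * a)) / (2 * pi) = a / d" if "d > 0" for d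
      using that by simp
    ultimately have "pi / (1 / 2 + l / a) / (2 * pi) = a / (a + 2 * l)"
      using a l by (simp only: add_pos_pos mult_pos_pos zero_less_numeral)
    then show ?thesis by (simp only: real_sqrt_divide[symmetric])
  qed
  finally show "(LINT x:{0..}|lborel. l * exp (- (l * x)) * gauss_Q (sqrt (a * x))) = 1 / 2 - sqrt (a / (a + 2 * l)) / 2"
    unfolding set_lebesgue_integral_def by (simp add: mult_ac)
qed

subsection \<open>Expectations over the two hops\<close>

text \<open>
  The coercion \<open>ennreal\<close> truncates negative values, so that \<open>f\<close> is nonnegative has to be recovered
  from its total mass.
\<close>

lemma (in prob_space) distributed_ennreal_AE_nonneg:
  assumes X: "distributed M lborel X (\<lambda>x. ennreal (f x))"
    and f: "integrable lborel f" "integral\<^sup>L lborel f = 1"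
  shows "AE x in lborel. 0 \<le> f x"
proof -
  have max: "ennreal (max 0 (f x)) = ennreal (f x)" for x
    by (simp add: max_def ennreal_neg)
  have f': "integrable lborel (\<lambda>x. max 0 (f x))" using f(1) by simp
  interpret D: prob_space "distr M lborel X"
    using distributed_measurable[OF X] by (rule prob_space_distr)
  have "(\<integral>\<^sup>+x. ennreal (f x) \<partial>lborel) = emeasure (distr M lborel X) (space (distr M lborel X))"
    unfolding distributed_distr_eq_density[OF X]
    using distributed_borel_measurable[OF X] by (simp add: emeasure_density)
  also have "\<dots> = 1" by (rule D.emeasure_space_1)
  finally have "ennreal (\<integral>x. max 0 (f x) \<partial>lborel) = 1"
    using nn_integral_eq_integral[OF f'] by (simp add: max)
  \<comment> \<open>\<open>f\<close> and its positive part both have integral 1, so the negative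
    part has integral 0.\<close>
  then have "(\<integral>x. max 0 (f x) - f x \<partial>lborel) = 0"
    using f f' by simp
  then have "AE x in lborel. max 0 (f x) - f x = 0"
    using integral_nonneg_eq_0_iff_AE[of lborel "\<lambda>x. max 0 (f x) - f x"] f f' by simp
  then show ?thesis by eventually_elim (simp add: max_def split: if_splits)
qed

lemma (in prob_space) expectation_distributed_ennreal:
  fixes f g :: "real \<Rightarrow> real"
  assumes X: "distributed M lborel X (\<lambda>x. ennreal (f x))"
    and f: "f \<in> borel_measurable borel" "AE x in lborel. 0 \<le> f x"
    and g: "g \<in> borel_measurable borel"
  shows "expectation (\<lambda>\<omega>. g (X \<omega>)) = (\<integral>x. f x * g x \<partial>lborel)"
proof -
  have "(\<lambda>x. ennreal (f x)) = (\<lambda>x. ennreal (max 0 (f x)))"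
    by (auto simp: max_def ennreal_neg)
  then have "distributed M lborel X (\<lambda>x. ennreal (max 0 (f x)))" using X by simp
  then have "expectation (\<lambda>\<omega>. g (X \<omega>)) = (\<integral>x. max 0 (f x) * g x \<partial>lborel)"
    using g by (intro distributed_integral[symmetric]) auto
  also have "\<dots> = (\<integral>x. f x * g x \<partial>lborel)"
    using f g by (intro integral_cong_AE) (auto elim!: eventually_mono)
  finally show ?thesis .
qed

text \<open>Conditioning on \<open>Y\<close>. The measurability claim is recorded because the inner
  expectation is later replaced by a formula that holds only almost surely.\<close>

lemma (in prob_space) expectation_indep_var_bounded:
  fixes F :: "real \<Rightarrow> real \<Rightarrow> real"
  assumes indep: "indep_var borel X borel Y"
    and F: "(\<lambda>z. F (fst z) (snd z)) \<in> borel_measurable (borel \<Otimes>\<^sub>M borel)"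
    and bound: "\<And>x y. \<bar>F x y\<bar> \<le> K"
  shows "(\<lambda>y. expectation (\<lambda>\<omega>. F (X \<omega>) y)) \<in> borel_measurable borel"
    and "expectation (\<lambda>\<omega>. F (X \<omega>) (Y \<omega>)) = expectation (\<lambda>\<omega>. expectation (\<lambda>\<omega>'. F (X \<omega>') (Y \<omega>)))"
proof -
  have [measurable]: "X \<in> borel_measurable M" "Y \<in> borel_measurable M"
    using indep by (auto elim: indep_var_rv1 indep_var_rv2)
  note F[measurable]
  interpret DX: prob_space "distr M borel X" by (rule prob_space_distr) simp
  interpret DY: prob_space "distr M borel Y" by (rule prob_space_distr) simp
  interpret P: pair_prob_space "distr M borel X" "distr M borel Y" ..
  have [measurable]: "(\<lambda>x. F x y) \<in> borel_measurable borel" for y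
    using measurable_compose[OF measurable_Pair2' F, of y] by simp
  have inner: "(\<integral>x. F x y \<partial>distr M borel X) = expectation (\<lambda>\<omega>. F (X \<omega>) y)" for y
    by (rule integral_distr) auto
  have F': "(\<lambda>z. F (fst z) (snd z)) \<in> borel_measurable (distr M borel X \<Otimes>\<^sub>M distr M borel Y)"
    using F by (simp cong: measurable_cong_sets)
  have int: "integrable (distr M borel X \<Otimes>\<^sub>M distr M borel Y) (\<lambda>(x, y). F x y)"
    using bound F' by (intro P.integrable_const_bound[of _ K]) (auto simp: split_beta)
  have "integrable (distr M borel Y) (\<lambda>y. expectation (\<lambda>\<omega>. F (X \<omega>) y))"
    using P.integrable_snd[OF int] unfolding inner .
  then show meas: "(\<lambda>y. expectation (\<lambda>\<omega>. F (X \<omega>) y)) \<in> borel_measurable borel"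
    using borel_measurable_integrable by fastforce
  have "expectation (\<lambda>\<omega>. F (X \<omega>) (Y \<omega>)) =
      (\<integral>z. F (fst z) (snd z) \<partial>distr M (borel \<Otimes>\<^sub>M borel) (\<lambda>\<omega>. (X \<omega>, Y \<omega>)))"
    by (subst integral_distr) auto
  also have "\<dots> = (\<integral>z. F (fst z) (snd z) \<partial>(distr M borel X \<Otimes>\<^sub>M distr M borel Y))"
    using indep unfolding indep_var_distribution_eq by simp
  also have "\<dots> = (\<integral>y. expectation (\<lambda>\<omega>. F (X \<omega>) y) \<partial>distr M borel Y)"
    using P.integral_snd[OF int] unfolding inner by (simp add: case_prod_unfold)
  also have "\<dots> = expectation (\<lambda>\<omega>. expectation (\<lambda>\<omega>'. F (X \<omega>') (Y \<omega>)))"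
    using meas by (intro integral_distr) auto
  finally show "expectation (\<lambda>\<omega>. F (X \<omega>) (Y \<omega>)) = expectation (\<lambda>\<omega>. expectation (\<lambda>\<omega>'. F (X \<omega>') (Y \<omega>)))" .
qed

section \<open>The RF density as a signed mixture of exponentials\<close>

lemma zeta1_pos:
  assumes "m \<le> M" "0 \<le> \<rho>" "\<rho> \<le> 1"
  shows "zeta1 M m \<rho> k > 0"
  using assms unfolding zeta1_def
  by (intro divide_pos_pos add_nonneg_pos mult_nonneg_nonneg) auto

text \<open>The coefficients of \<open>rf_density\<close> with respect to normalised exponential
  densities of rates \<open>zeta1 M m \<rho> k / \<mu>\<close>. They alternate in sign, so
  nonnegativity of the density is not visible term by term.\<close>

definition rf_weight :: "nat \<Rightarrow> nat \<Rightarrow> nat \<Rightarrow> real" where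
  "rf_weight M m k = real m * real (M choose m) *
     ((-1) ^ k * real ((m - 1) choose k) / (real M - real m + real k + 1))"

lemma rf_density_eq_sum:
  assumes "m \<le> M" "0 \<le> \<rho>" "\<rho> \<le> 1" "\<mu> > 0"
  shows "rf_density M m \<rho> \<mu> x = (\<Sum>k<m. rf_weight M m k *
    (indicator {0..} x *\<^sub>R (zeta1 M m \<rho> k / \<mu> * exp (- (zeta1 M m \<rho> k / \<mu> * x)))))"
proof (cases "x \<ge> 0")
  case True
  have "(-1) ^ k * real ((m - 1) choose k) / (D * \<mu>) * exp (- (N * x) / (D * \<mu>)) =
      (-1) ^ k * real ((m - 1) choose k) / N * (N / D / \<mu> * exp (- (N / D / \<mu> * x)))"
    if "N > 0" for N D k
    using that by (simp add: field_simps)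
  moreover have "real M - real m + real k + 1 > 0" "real M - real m + real k + 1 \<noteq> 0" for k
    using assms(1) by simp_all
  ultimately show ?thesis
    using True by (simp add: rf_density_def rf_weight_def zeta1_def sum_distrib_left mult.assoc)
qed (simp add: rf_density_def)

lemma rf_density_integral:
  assumes "1 \<le> m" "m \<le> M" "0 \<le> \<rho>" "\<rho> \<le> 1" "\<mu> > 0"
  shows "integrable lborel (rf_density M m \<rho> \<mu>)" and "integral\<^sup>L lborel (rf_density M m \<rho> \<mu>) = 1"
proof -
  let ?l = "\<lambda>k. zeta1 M m \<rho> k / \<mu>"
  let ?e = "\<lambda>k x. indicator {0..} x *\<^sub>R (?l k * exp (- (?l k * x)))"
  have l: "?l k > 0" for k using zeta1_pos[OF assms(2-4)] assms(5) by simp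
  have e: "integrable lborel (?e k)" "integral\<^sup>L lborel (?e k) = 1" for k
    using exponential_set_integral[OF l] unfolding set_integrable_def set_lebesgue_integral_def by auto
  have eq: "rf_density M m \<rho> \<mu> = (\<lambda>x. \<Sum>k<m. rf_weight M m k * ?e k x)"
    using rf_density_eq_sum[OF assms(2-5)] by blast
  show "integrable lborel (rf_density M m \<rho> \<mu>)"
    unfolding eq by (intro Bochner_Integration.integrable_sum integrable_mult_right e)
  have "integral\<^sup>L lborel (rf_density M m \<rho> \<mu>) = (\<Sum>k<m. rf_weight M m k * integral\<^sup>L lborel (?e k))"
    unfolding eq
    by (subst Bochner_Integration.integral_sum) (intro integrable_mult_right e, simp only: integral_mult_right_zero)
  also have "\<dots> = (\<Sum>k<m. rf_weight M m k)"
    unfolding e(2) by simp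
  also have "\<dots> = 1"
    using rf_weights_sum[OF assms(1,2)] unfolding rf_weight_def sum_distrib_left[symmetric] .
  finally show "integral\<^sup>L lborel (rf_density M m \<rho> \<mu>) = 1" .
qed

text \<open>Each exponential component contributes \<open>1 / 2\<close> minus half a square root; as
  the weights sum to 1, the halves add up to a single \<open>1 / 2\<close>.\<close>

lemma rf_density_gauss_Q:
  assumes "1 \<le> m" "m \<le> M" "0 \<le> \<rho>" "\<rho> \<le> 1" "\<mu> > 0" "a > 0"
  shows "(\<integral>x. rf_density M m \<rho> \<mu> x * gauss_Q (sqrt (a * x)) \<partial>lborel) =
    1 / 2 - (\<Sum>k<m. rf_weight M m k / 2 * sqrt (a / (a + 2 * (zeta1 M m \<rho> k / \<mu>))))"
proof -
  let ?l = "\<lambda>k. zeta1 M m \<rho> k / \<mu>"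
  let ?e = "\<lambda>k x. indicator {0..} x *\<^sub>R (?l k * exp (- (?l k * x)) * gauss_Q (sqrt (a * x)))"
  have l: "?l k > 0" for k using zeta1_pos[OF assms(2-4)] assms(5) by simp
  have e: "integrable lborel (?e k)" "integral\<^sup>L lborel (?e k) = 1 / 2 - sqrt (a / (a + 2 * ?l k)) / 2" for k
    using laplace_gauss_Q_sqrt[OF assms(6) l] unfolding set_integrable_def set_lebesgue_integral_def by auto
  have eq: "rf_density M m \<rho> \<mu> x * gauss_Q (sqrt (a * x)) = (\<Sum>k<m. rf_weight M m k * ?e k x)" for x
    unfolding rf_density_eq_sum[OF assms(2-5)] sum_distrib_right
    by (intro sum.cong refl) (simp only: mult_scaleR_left mult.assoc)
  have "(\<integral>x. rf_density M m \<rho> \<mu> x * gauss_Q (sqrt (a * x)) \<partial>lborel) =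
      (\<Sum>k<m. rf_weight M m k * integral\<^sup>L lborel (?e k))"
    unfolding eq
    by (subst Bochner_Integration.integral_sum) (intro integrable_mult_right e, simp only: integral_mult_right_zero)
  also have "\<dots> = (\<Sum>k<m. rf_weight M m k) / 2 - (\<Sum>k<m. rf_weight M m k / 2 * sqrt (a / (a + 2 * ?l k)))"
    unfolding e(2) by (simp add: right_diff_distrib sum_subtractf sum_divide_distrib)
  also have "(\<Sum>k<m. rf_weight M m k) = 1"
    using rf_weights_sum[OF assms(1,2)] unfolding rf_weight_def sum_distrib_left[symmetric] .
  finally show ?thesis .
qed

section \<open>Averaging over the optical hop\<close>

context
  fixes r \<beta> :: nat and \<mu> \<xi> \<alpha> g \<Omega> B :: real
  assumes r: "r \<in> {1, 2}" and pos: "\<mu> > 0" "\<xi> > 0" "\<alpha> > 0" "g > 0" "\<Omega> > 0" "B > 0"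
begin

private abbreviation G where
  "G n x \<equiv> meijer_G 3 0 [of_real (\<xi>\<^sup>2 + 1)] [of_real (\<xi>\<^sup>2), of_real \<alpha>, of_nat n]
     (of_real (B * (x / \<mu>) powr (1 / real r)))"

lemma meijer_G_optical_nonneg:
  assumes "x > 0" "n \<ge> 1"
  shows "G n x \<in> \<real>\<^sub>\<ge>\<^sub>0"
  using meijer_G_3_0_nonneg[of "B * (x / \<mu>) powr (1 / real r)" "\<xi>\<^sup>2" \<alpha> "real n"] assms pos
  by simp

text \<open>In contrast to the RF weights all coefficients are nonnegative, so positivity of the
  single G-functions is enough, and it holds pointwise.\<close>

lemma optical_density_nonneg: "0 \<le> optical_density r \<mu> \<xi> \<alpha> \<beta> g \<Omega> B x"
proof (cases "x > 0")
  case True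
  have "0 \<le> Re (G n x)" if "n \<ge> 1" for n
    using meijer_G_optical_nonneg[OF True that] by (simp add: complex_nonneg_Reals_iff)
  moreover have "malaga_b \<alpha> \<beta> g \<Omega> n \<ge> 0" for n
    using pos by (simp add: malaga_b_def malaga_a_def)
  moreover have "malaga_A \<alpha> \<beta> g \<Omega> \<ge> 0"
    using pos Gamma_real_pos[OF pos(3)] by (simp add: malaga_A_def)
  ultimately show ?thesis
    using True by (auto simp: optical_density_def intro!: mult_nonneg_nonneg sum_nonneg divide_nonneg_nonneg)
qed (simp add: optical_density_def)

text \<open>The \<open>1 / x\<close> of the density supplies the invariant measure of a Mellin
  convolution, so the convolution formula applies to each \<open>n\<close>. Dividing by
  \<open>sqrt pi\<close> undoes the \<open>Gamma (1 / 2)\<close> carried on the left side of that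
  formula.\<close>

lemma optical_density_inverse_sqrt:
  assumes q: "q > 0"
  shows "complex_of_real (\<integral>x. optical_density r \<mu> \<xi> \<alpha> \<beta> g \<Omega> B x * (1 + q / x) powr (- (1 / 2)) \<partial>lborel) =
    (\<Sum>n=1..\<beta>. of_real (\<xi>\<^sup>2 * malaga_A \<alpha> \<beta> g \<Omega> / 2 ^ r * malaga_b \<alpha> \<beta> g \<Omega> n *
        (real r powr (\<alpha> + real n - 1) / (2 * pi) ^ (r - 1)) / sqrt pi) *
      meijer_G (3 * r + 1) 1 (tau6 r \<xi>) (tau4 r \<xi> \<alpha> n) (of_real (q * (B / (real r)\<^sup>2) ^ r / \<mu>)))"
proof -
  let ?A = "\<xi>\<^sup>2 * malaga_A \<alpha> \<beta> g \<Omega> / 2 ^ r"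
  let ?b = "malaga_b \<alpha> \<beta> g \<Omega>"
  let ?T = "\<lambda>n. meijer_G (3 * r + 1) 1 (tau6 r \<xi>) (tau4 r \<xi> \<alpha> n) (of_real (q * (B / (real r)\<^sup>2) ^ r / \<mu>))"
  let ?F = "\<lambda>n x. indicator {0<..} x *\<^sub>R (of_real ((1 + q / x) powr (- (1 / 2)) / x) * G n x)"
  have F: "integrable lborel (?F n)"
    "integral\<^sup>L lborel (?F n) =
       of_real (real r powr (\<alpha> + real n - 1) / (2 * pi) ^ (r - 1)) * ?T n / of_real (sqrt pi)"
    if "n \<ge> 1" for n
    using meijer_G_3_0_mellin_convolution[OF r pos(2,3) that pos(6,1) q]
    unfolding set_integrable_def set_lebesgue_integral_def by (auto simp: field_simps)
  have "complex_of_real (optical_density r \<mu> \<xi> \<alpha> \<beta> g \<Omega> B x * (1 + q / x) powr (- (1 / 2))) =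
      (\<Sum>n=1..\<beta>. of_real (?A * ?b n) * ?F n x)" for x
  proof (cases "x > 0")
    case True
    have "complex_of_real (Re (G n x)) = G n x" if "n \<ge> 1" for n
      using meijer_G_optical_nonneg[OF True that] by (simp add: complex_nonneg_Reals_iff complex_eq_iff)
    then have sum: "complex_of_real (\<Sum>n=1..\<beta>. ?b n * Re (G n x)) = (\<Sum>n=1..\<beta>. of_real (?b n) * G n x)"
      by (simp add: of_real_sum)
    have "optical_density r \<mu> \<xi> \<alpha> \<beta> g \<Omega> B x * (1 + q / x) powr (- (1 / 2)) =
        ?A * ((1 + q / x) powr (- (1 / 2)) / x) * (\<Sum>n=1..\<beta>. ?b n * Re (G n x))"
      using True by (simp add: optical_density_def)
    then have "complex_of_real (optical_density r \<mu> \<xi> \<alpha> \<beta> g \<Omega> B x * (1 + q / x) powr (- (1 / 2))) =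
        of_real (?A * ((1 + q / x) powr (- (1 / 2)) / x)) * (\<Sum>n=1..\<beta>. of_real (?b n) * G n x)"
      unfolding sum[symmetric] by (simp only: of_real_mult)
    also have "\<dots> = (\<Sum>n=1..\<beta>. of_real (?A * ?b n) * ?F n x)"
      unfolding sum_distrib_left using True by (intro sum.cong refl) (simp add: mult_ac)
    finally show ?thesis .
  qed (simp add: optical_density_def)
  then have "complex_of_real (\<integral>x. optical_density r \<mu> \<xi> \<alpha> \<beta> g \<Omega> B x * (1 + q / x) powr (- (1 / 2)) \<partial>lborel) =
      (\<integral>x. (\<Sum>n=1..\<beta>. of_real (?A * ?b n) * ?F n x) \<partial>lborel)"
    unfolding integral_complex_of_real[symmetric] by (simp only:)
  also have "\<dots> = (\<Sum>n=1..\<beta>. of_real (?A * ?b n) * integral\<^sup>L lborel (?F n))"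
  proof -
    have "(\<integral>x. (\<Sum>n=1..\<beta>. of_real (?A * ?b n) * ?F n x) \<partial>lborel) =
        (\<Sum>n=1..\<beta>. \<integral>x. of_real (?A * ?b n) * ?F n x \<partial>lborel)"
      by (rule Bochner_Integration.integral_sum) (intro integrable_mult_right F(1), simp)
    then show ?thesis by (simp only: integral_mult_right_zero)
  qed
  also have "\<dots> = (\<Sum>n=1..\<beta>. of_real (?A * ?b n *
        (real r powr (\<alpha> + real n - 1) / (2 * pi) ^ (r - 1)) / sqrt pi) * ?T n)"
  proof (intro sum.cong refl)
    fix n assume "n \<in> {1..\<beta>}"
    then have "n \<ge> 1" by simp
    have "of_real a * (of_real k * t / of_real p) = of_real (a * k / p) * t" for a k p :: real and t :: complex
      by (simp add: mult.assoc)
    then show "of_real (?A * ?b n) * integral\<^sup>L lborel (?F n) = of_real (?A * ?b n *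
        (real r powr (\<alpha> + real n - 1) / (2 * pi) ^ (r - 1)) / sqrt pi) * ?T n"
      unfolding F(2)[OF \<open>n \<ge> 1\<close>] .
  qed
  finally show ?thesis .
qed

end

section \<open>Combining the two hops\<close>

lemma sqrt_hop_ratio:
  fixes c l C y :: real
  assumes "c > 0" "l > 0" "C > 0" "y > 0"
  shows "sqrt (c * y / (y + C) / (c * y / (y + C) + 2 * l)) =
    sqrt (c / (c + 2 * l)) * (1 + 2 * l * C / (c + 2 * l) / y) powr (- (1 / 2))"
proof -
  \<comment> \<open>\<open>q\<close> is the number for which \<open>c * y + 2 * l * (y + C)\<close>
    factors as \<open>(c + 2 * l) * (y + q)\<close>.\<close>
  define q where "q = 2 * l * C / (c + 2 * l)"
  have pos: "y + C > 0" "c + 2 * l > 0" "q > 0" using assms by (simp_all add: q_def add_pos_pos)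
  have qc: "q * (c + 2 * l) = 2 * l * C" using pos by (simp add: q_def)
  have "c * y / (y + C) / (c * y / (y + C) + 2 * l) = c * y / (c * y + 2 * l * (y + C))"
  proof -
    have "c * y / (y + C) + 2 * l = (c * y + 2 * l * (y + C)) / (y + C)"
      using pos by (simp add: add_divide_distrib)
    then show ?thesis using pos by simp
  qed
  also have "c * y + 2 * l * (y + C) = (c + 2 * l) * (y + q)"
    using qc by (simp add: algebra_simps)
  also have "c * y / \<dots> = c / (c + 2 * l) * inverse (1 + q / y)"
    using assms(4) pos by (simp add: field_simps)
  finally have "sqrt (c * y / (y + C) / (c * y / (y + C) + 2 * l)) =
      sqrt (c / (c + 2 * l)) * inverse (sqrt (1 + q / y))"
    by (simp only: real_sqrt_mult real_sqrt_inverse)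
  also have "inverse (sqrt (1 + q / y)) = (1 + q / y) powr (- (1 / 2))"
    using pos assms(4) by (simp add: powr_minus powr_half_sqrt add_pos_pos)
  finally show ?thesis unfolding q_def .
qed

theorem mainTheorem4:
  fixes P :: "'w measure" and \<gamma>1 \<gamma>2 :: "'w \<Rightarrow> real"
    and M m r \<beta> :: nat
    and \<rho> \<mu>1 \<mu>r \<xi> \<alpha> g \<Omega> B c C :: real
  assumes "prob_space P"
    and "M \<ge> 1" and "1 \<le> m" and "m \<le> M" and "0 \<le> \<rho>" and "\<rho> \<le> 1" and "\<mu>1 > 0"
    and "r \<in> {1, 2}" and "\<mu>r > 0" and "\<xi> > 0" and "\<alpha> > 0" and "\<beta> \<ge> 1"
    and "g > 0" and "\<Omega> > 0" and "B > 0" and "c > 0"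
    and "distributed P lborel \<gamma>1 (\<lambda>x. ennreal (rf_density M m \<rho> \<mu>1 x))"
    and "distributed P lborel \<gamma>2 (\<lambda>x. ennreal (optical_density r \<mu>r \<xi> \<alpha> \<beta> g \<Omega> B x))"
    and "prob_space.indep_var P borel \<gamma>1 borel \<gamma>2"
    and "C = prob_space.expectation P \<gamma>1 + 1"
  shows "complex_of_real
           (prob_space.expectation P
              (\<lambda>\<omega>. gauss_Q (sqrt (c * (\<gamma>1 \<omega> * \<gamma>2 \<omega> / (\<gamma>2 \<omega> + C)))))) =
         1 / 2 -
         complex_of_real
           (sqrt (c / (8 * pi)) *
            (real m * \<xi>\<^sup>2 * malaga_A \<alpha> \<beta> g \<Omega> / (2 ^ r * (2 * pi) ^ (r - 1))) *
            real (M choose m)) *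
         (\<Sum>k<m. \<Sum>n=1..\<beta>.
            complex_of_real
              (real ((m - 1) choose k) *
               ((-1) ^ k * malaga_b \<alpha> \<beta> g \<Omega> n * real r powr (\<alpha> + real n - 1) /
                (real M - real m + real k + 1)) *
               sqrt (2 * \<mu>1 / (c * \<mu>1 + 2 * zeta1 M m \<rho> k))) *
            meijer_G (3 * r + 1) 1 (tau6 r \<xi>) (tau4 r \<xi> \<alpha> n)
              (complex_of_real (2 * zeta2 M m \<rho> C B r k / ((c * \<mu>1 + 2 * zeta1 M m \<rho> k) * \<mu>r))))"
proof -
  note P = assms(1) and par = assms(2-16) and d1 = assms(17) and d2 = assms(18) and indep = assms(19) and Cdef = assms(20)
  interpret prob_space P by (rule P)
  let ?f1 = "rf_density M m \<rho> \<mu>1" and ?f2 = "optical_density r \<mu>r \<xi> \<alpha> \<beta> g \<Omega> B"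
  have [measurable]: "\<gamma>1 \<in> borel_measurable P" "\<gamma>2 \<in> borel_measurable P"
    using distributed_measurable[OF d1] distributed_measurable[OF d2] by simp_all
  have f1: "integrable lborel ?f1" "integral\<^sup>L lborel ?f1 = 1"
    using rf_density_integral par by auto
  have f1_nonneg: "AE x in lborel. 0 \<le> ?f1 x"
    using d1 f1 by (rule distributed_ennreal_AE_nonneg)
  have f2_nonneg: "0 \<le> ?f2 x" for x
    using par by (intro optical_density_nonneg) auto
  have f2_meas: "?f2 \<in> borel_measurable borel"
    using distributed_real_measurable[OF f2_nonneg d2] by simp
  \<comment> \<open>The density vanishes on the negative half-line. Hence the mean of
    \<open>\<gamma>1\<close> is nonnegative and \<open>C\<close> positive, which keeps
    \<open>y + C\<close> away from 0.\<close>
  have "AE \<omega> in P. 0 \<le> \<gamma>1 \<omega>"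
    by (subst distributed_AE2[OF d1]) (auto simp: rf_density_def intro!: AE_I2)
  then have "C \<ge> 1"
    unfolding Cdef using integral_nonneg_AE by fastforce
  then have C: "C > 0" by simp
  have \<gamma>2_pos: "AE \<omega> in P. 0 < \<gamma>2 \<omega>"
    by (subst distributed_AE2[OF d2]) (auto simp: optical_density_def intro!: AE_I2)
  \<comment> \<open>\<open>l k\<close> is the rate of the \<open>k\<close>-th exponential component
    of the law of \<open>\<gamma>1\<close>, and \<open>q k\<close> the constant that
    \<open>sqrt_hop_ratio\<close> produces for this rate.\<close>
  define l where "l = (\<lambda>k. zeta1 M m \<rho> k / \<mu>1)"
  define q where "q = (\<lambda>k. 2 * l k * C / (c + 2 * l k))"
  have l: "l k > 0" for k
    using zeta1_pos[of m M \<rho> k] par by (simp add: l_def)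
  have cl: "c + 2 * l k > 0" for k using l[of k] par by (simp add: add_pos_pos)
  have q: "q k > 0" for k using l cl C by (simp add: q_def)
  let ?F = "\<lambda>x y. gauss_Q (sqrt (c * (x * y / (y + C))))"
  let ?s = "\<lambda>k y. (1 + q k / y) powr (- (1 / 2))"
  let ?w = "\<lambda>k. rf_weight M m k / 2 * sqrt (c / (c + 2 * l k))"
  have F_meas: "(\<lambda>z. ?F (fst z) (snd z)) \<in> borel_measurable (borel \<Otimes>\<^sub>M borel)" by measurable
  have cond: "expectation (\<lambda>\<omega>. ?F (\<gamma>1 \<omega>) y) = 1 / 2 - (\<Sum>k<m. ?w k * ?s k y)" if y: "y > 0" for y
  proof -
    \<comment> \<open>For a fixed second hop \<open>y\<close> the end-to-end SNR is linear in
      \<open>\<gamma>1\<close>; \<open>a\<close> is its slope times \<open>c\<close>.\<close>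
    define a where "a = c * y / (y + C)"
    have a: "a > 0" using y C par by (simp add: a_def)
    have "c * (x * y / (y + C)) = a * x" for x by (simp add: a_def)
    then have "expectation (\<lambda>\<omega>. ?F (\<gamma>1 \<omega>) y) = expectation (\<lambda>\<omega>. gauss_Q (sqrt (a * \<gamma>1 \<omega>)))"
      by simp
    also have "\<dots> = (\<integral>x. ?f1 x * gauss_Q (sqrt (a * x)) \<partial>lborel)"
      using borel_measurable_integrable[OF f1(1)] f1_nonneg
      by (intro expectation_distributed_ennreal[OF d1]) auto
    also have "\<dots> = 1 / 2 - (\<Sum>k<m. rf_weight M m k / 2 * sqrt (a / (a + 2 * l k)))"
      unfolding l_def using par a by (intro rf_density_gauss_Q) auto
    also have "\<dots> = 1 / 2 - (\<Sum>k<m. ?w k * ?s k y)"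
    proof -
      have "sqrt (a / (a + 2 * l k)) = sqrt (c / (c + 2 * l k)) * ?s k y" for k
        unfolding a_def q_def using par l C y by (intro sqrt_hop_ratio) auto
      then show ?thesis by (simp only: mult.assoc)
    qed
    finally show ?thesis .
  qed
  have s_int: "integrable P (\<lambda>\<omega>. ?s k (\<gamma>2 \<omega>))" for k
  proof (rule integrable_const_bound)
    show "AE \<omega> in P. norm (?s k (\<gamma>2 \<omega>)) \<le> 1"
      using \<gamma>2_pos
    proof eventually_elim
      case (elim \<omega>)
      then have "1 \<le> 1 + q k / \<gamma>2 \<omega>" using q[of k] by simp
      then have "(1 + q k / \<gamma>2 \<omega>) powr (- (1 / 2)) \<le> (1 + q k / \<gamma>2 \<omega>) powr 0"
        by (intro powr_mono) auto
      then show ?case using \<open>1 \<le> 1 + q k / \<gamma>2 \<omega>\<close> by simp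
    qed
  qed simp
  have s_exp: "expectation (\<lambda>\<omega>. ?s k (\<gamma>2 \<omega>)) = (\<integral>y. ?f2 y * ?s k y \<partial>lborel)" for k
    using f2_meas f2_nonneg by (intro expectation_distributed_ennreal[OF d2]) auto
  have "expectation (\<lambda>\<omega>. ?F (\<gamma>1 \<omega>) (\<gamma>2 \<omega>)) = expectation (\<lambda>\<omega>. expectation (\<lambda>\<omega>'. ?F (\<gamma>1 \<omega>') (\<gamma>2 \<omega>)))"
    using indep F_meas by (rule expectation_indep_var_bounded(2)[where K = 1]) (simp add: gauss_Q_bounds)
  \<comment> \<open>\<open>cond\<close> is available for \<open>y > 0\<close> only, which covers
    almost every value of \<open>\<gamma>2\<close>.\<close>
  also have "\<dots> = expectation (\<lambda>\<omega>. 1 / 2 - (\<Sum>k<m. ?w k * ?s k (\<gamma>2 \<omega>)))"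
  proof (rule integral_cong_AE)
    have "(\<lambda>y. expectation (\<lambda>\<omega>'. ?F (\<gamma>1 \<omega>') y)) \<in> borel_measurable borel"
      using indep F_meas by (rule expectation_indep_var_bounded(1)[where K = 1]) (simp add: gauss_Q_bounds)
    then show "(\<lambda>\<omega>. expectation (\<lambda>\<omega>'. ?F (\<gamma>1 \<omega>') (\<gamma>2 \<omega>))) \<in> borel_measurable P"
      by (rule measurable_compose[rotated]) simp
    show "AE \<omega> in P. expectation (\<lambda>\<omega>'. ?F (\<gamma>1 \<omega>') (\<gamma>2 \<omega>)) = 1 / 2 - (\<Sum>k<m. ?w k * ?s k (\<gamma>2 \<omega>))"
      using \<gamma>2_pos by eventually_elim (rule cond)
  qed simp
  also have "\<dots> = 1 / 2 - (\<Sum>k<m. ?w k * expectation (\<lambda>\<omega>. ?s k (\<gamma>2 \<omega>)))"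
    using s_int by (simp add: prob_space)
  finally have E: "expectation (\<lambda>\<omega>. ?F (\<gamma>1 \<omega>) (\<gamma>2 \<omega>)) = 1 / 2 - (\<Sum>k<m. ?w k * (\<integral>y. ?f2 y * ?s k y \<partial>lborel))"
    unfolding s_exp .
  let ?T = "\<lambda>k n. meijer_G (3 * r + 1) 1 (tau6 r \<xi>) (tau4 r \<xi> \<alpha> n)
              (complex_of_real (2 * zeta2 M m \<rho> C B r k / ((c * \<mu>1 + 2 * zeta1 M m \<rho> k) * \<mu>r)))"
  let ?u = "\<lambda>n. \<xi>\<^sup>2 * malaga_A \<alpha> \<beta> g \<Omega> / 2 ^ r * malaga_b \<alpha> \<beta> g \<Omega> n *
        (real r powr (\<alpha> + real n - 1) / (2 * pi) ^ (r - 1)) / sqrt pi"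
  let ?c0 = "sqrt (c / (8 * pi)) *
            (real m * \<xi>\<^sup>2 * malaga_A \<alpha> \<beta> g \<Omega> / (2 ^ r * (2 * pi) ^ (r - 1))) * real (M choose m)"
  let ?c1 = "\<lambda>k n. real ((m - 1) choose k) *
               ((-1) ^ k * malaga_b \<alpha> \<beta> g \<Omega> n * real r powr (\<alpha> + real n - 1) /
                (real M - real m + real k + 1)) *
               sqrt (2 * \<mu>1 / (c * \<mu>1 + 2 * zeta1 M m \<rho> k))"
  \<comment> \<open>\<open>l\<close> contains \<open>1 / \<mu>1\<close>; clearing it gives the
    denominators of the statement.\<close>
  have cl_eq: "c * \<mu>1 + 2 * zeta1 M m \<rho> k = (c + 2 * l k) * \<mu>1" for k
    using par by (simp add: l_def field_simps)
  have arg: "q k * (B / (real r)\<^sup>2) ^ r / \<mu>r = 2 * zeta2 M m \<rho> C B r k / ((c * \<mu>1 + 2 * zeta1 M m \<rho> k) * \<mu>r)" for k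
  proof -
    have "zeta2 M m \<rho> C B r k = l k * \<mu>1 * C * (B / (real r)\<^sup>2) ^ r"
      using par by (simp add: zeta2_def zeta1_def l_def)
    then show ?thesis
      unfolding cl_eq q_def using par by simp
  qed
  have coeff: "?w k * ?u n = ?c0 * ?c1 k n" for k n
  proof -
    \<comment> \<open>The half in \<open>?w\<close> and the \<open>sqrt pi\<close> in
      \<open>?u\<close> make \<open>1 / sqrt (4 * pi)\<close>; the statement has 8 in place of 4 and
      compensates by the 2 in \<open>2 * \<mu>1\<close>.\<close>
    have roots: "sqrt (c / (8 * pi)) * sqrt (2 * \<mu>1 / ((c + 2 * l k) * \<mu>1)) = sqrt (c / (c + 2 * l k)) / (2 * sqrt pi)"
    proof -
      have "c / (8 * pi) * (2 * \<mu>1 / ((c + 2 * l k) * \<mu>1)) = c / (c + 2 * l k) / (2\<^sup>2 * pi)"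
        using par by simp
      then have "sqrt (c / (8 * pi)) * sqrt (2 * \<mu>1 / ((c + 2 * l k) * \<mu>1)) = sqrt (c / (c + 2 * l k) / (2\<^sup>2 * pi))"
        by (simp only: real_sqrt_mult[symmetric])
      also have "\<dots> = sqrt (c / (c + 2 * l k)) / (sqrt (2\<^sup>2) * sqrt pi)"
        by (simp only: real_sqrt_divide[of "c / (c + 2 * l k)"] real_sqrt_mult)
      finally show ?thesis by simp
    qed
    have wu: "?w k * ?u n = sqrt (c / (c + 2 * l k)) / (2 * sqrt pi) *
      (real m * \<xi>\<^sup>2 * malaga_A \<alpha> \<beta> g \<Omega> / (2 ^ r * (2 * pi) ^ (r - 1)) * real (M choose m) *
      (real ((m - 1) choose k) * ((-1) ^ k * malaga_b \<alpha> \<beta> g \<Omega> n * real r powr (\<alpha> + real n - 1) /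
                (real M - real m + real k + 1))))"
    proof -
      \<comment> \<open>Stated for arbitrary reals, so that the factors of the actual terms stay
        opaque during the rearrangement.\<close>
      have "a1 * a2 * (a3 * a4 / N) / 2 * S * (a5 * a6 / d1 * a7 * (a8 / d2) / d3) =
          S / (2 * d3) * (a1 * a5 * a6 / (d1 * d2) * a2 * (a4 * (a3 * a7 * a8 / N)))"
        for a1 a2 a3 a4 a5 a6 a7 a8 d1 d2 d3 N S :: real
        by (simp add: mult_ac)
      then show ?thesis unfolding rf_weight_def .
    qed
    have "s1 * x1 * x2 * (y1 * y2 * s2) = s1 * s2 * (x1 * x2 * (y1 * y2))" for s1 s2 x1 x2 y1 y2 :: real
      by (simp add: mult_ac)
    from this[symmetric] show ?thesis
      unfolding cl_eq wu roots[symmetric] .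
  qed
  have "complex_of_real (\<Sum>k<m. ?w k * (\<integral>y. ?f2 y * ?s k y \<partial>lborel)) =
      (\<Sum>k<m. \<Sum>n=1..\<beta>. of_real (?w k * ?u n) * ?T k n)"
  proof -
    have "complex_of_real (\<integral>y. ?f2 y * ?s k y \<partial>lborel) = (\<Sum>n=1..\<beta>. of_real (?u n) * ?T k n)" for k
      unfolding arg[symmetric] using par q by (intro optical_density_inverse_sqrt) auto
    then show ?thesis
      by (simp only: of_real_sum of_real_mult sum_distrib_left mult.assoc)
  qed
  also have "\<dots> = of_real ?c0 * (\<Sum>k<m. \<Sum>n=1..\<beta>. of_real (?c1 k n) * ?T k n)"
    unfolding coeff of_real_mult[of ?c0] sum_distrib_left by (simp only: mult.assoc)
  finally show ?thesis
    unfolding E by (simp only: of_real_diff of_real_divide of_real_1 of_real_numeral)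
qed

end
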